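(* Let $m\ge1$ be an integer. The map $\Psi:(\underline{c},\underline{d})\mapsto\dim_H(M_{\underline{c},\underline{d}})$, defined for pairs $\underline{c},\underline{d}\in\Sigma_{m+1}$ with $\underline{c}<\underline{d}$, is continuous. In particular, the functions $\psi:\underline{c}\mapsto\dim_H(M_{\underline{c}})$ and $\widetilde{\psi}:\underline{c}\mapsto\dim_H(N_{\underline{c}})$ on $\Sigma_{m+1}$ are continuous.
   Context: $\Sigma_{m+1}=\{0,1,\ldots,m\}^{\mathbb{N}}$ (sequences $\underline{x}=(x_1,x_2,\ldots)$) is equipped with the shift $(\sigma(\underline{x}))_i=x_{i+1}$, the lexicographic order $<$, the product topology, and the compatible metric $d(\underline{a},\underline{b})=\sum_{i\ge1}|a_i-b_i|/(m+1)^i$, with respect to which Hausdorff dimension $\dim_H$ is taken. For $\underline{c},\underline{d}\in\Sigma_{m+1}$, $$M_{\underline{c},\underline{d}}=\{\underline{x}\in\Sigma_{m+1}:\ \underline{c}\le\sigma^n(\underline{x})<\underline{x}\le\underline{d},\ \forall n\ge1\},$$ $$M_{\underline{c}}=\{\underline{x}\in\Sigma_{m+1}:\ \sigma^n(\underline{x})<\underline{x}\le\underline{c},\ \forall n>0\},$$ $$N_{\underline{c}}=\{\underline{x}\in\Sigma_{m+1}:\ \underline{c}\le\sigma^n(\underline{x})<\underline{x},\ \forall n\ge1\}.$$ The set of pairs $(\underline{c},\underline{d})$ carries the topology induced from $\Sigma_{m+1}\times\Sigma_{m+1}$. *)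

theory Defs
  imports "HOL-Analysis.Analysis" "HOL-Library.Fun_Lexorder"
begin

section \<open>Hausdorff measure and dimension in a metric space\<close>

definition mdiam :: "'a metric \<Rightarrow> 'a set \<Rightarrow> ennreal"
  where "mdiam X U = (SUP (x, y) \<in> U \<times> U. ennreal (mdist X x y))"

text \<open>The explicit cases implement the conventions that the empty set contributes nothing and that
  a nonempty set contributes 1 when \<open>s = 0\<close>, whereas in the library \<open>0 powr 0 = 0\<close>.
  It is only applied to sets of finite diameter.\<close>

definition diam_powr :: "'a metric \<Rightarrow> real \<Rightarrow> 'a set \<Rightarrow> ennreal"
  where "diam_powr X s U =
    (if U = {} then 0 else if s = 0 then 1 else ennreal (enn2real (mdiam X U) powr s))"

text \<open>The members of a cover may be empty, so finite covers are included.\<close>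

definition mesh_covers :: "'a metric \<Rightarrow> real \<Rightarrow> 'a set \<Rightarrow> (nat \<Rightarrow> 'a set) set"
  where "mesh_covers X \<delta> A =
    {U. (\<forall>i. U i \<subseteq> mspace X \<and> mdiam X (U i) \<le> ennreal \<delta>) \<and> A \<subseteq> (\<Union>i. U i)}"

definition hausdorff_premeasure :: "'a metric \<Rightarrow> real \<Rightarrow> real \<Rightarrow> 'a set \<Rightarrow> ennreal"
  where "hausdorff_premeasure X s \<delta> A = (INF U \<in> mesh_covers X \<delta> A. \<Sum>i. diam_powr X s (U i))"

definition hausdorff_measure :: "'a metric \<Rightarrow> real \<Rightarrow> 'a set \<Rightarrow> ennreal"
  where "hausdorff_measure X s A = (SUP \<delta> \<in> {0<..}. hausdorff_premeasure X s \<delta> A)"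

text \<open>In particular the empty set has dimension 0.\<close>

definition hausdorff_dim :: "'a metric \<Rightarrow> 'a set \<Rightarrow> ennreal"
  where "hausdorff_dim X A = Inf (ennreal ` {s. 0 \<le> s \<and> hausdorff_measure X s A = 0})"

section \<open>Sequences over \<open>{0, \<dots>, m}\<close>\<close>

text \<open>The entry \<open>x\<^sub>i\<close>, \<open>i \<ge> 1\<close>, of a sequence is \<open>x (i - 1)\<close>. The type \<^typ>\<open>nat \<Rightarrow> nat\<close> carries
  the product of the discrete topologies, but the pointwise order; the lexicographic order is
  \<^const>\<open>less_fun\<close>.\<close>

definition seqs :: "nat \<Rightarrow> (nat \<Rightarrow> nat) set"
  where "seqs m = {x. \<forall>i. x i \<le> m}"

definition shift :: "(nat \<Rightarrow> nat) \<Rightarrow> nat \<Rightarrow> nat"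
  where "shift x = (\<lambda>i. x (Suc i))"

abbreviation lex_less :: "(nat \<Rightarrow> nat) \<Rightarrow> (nat \<Rightarrow> nat) \<Rightarrow> bool"  (infix \<open>\<prec>\<close> 50)
  where "x \<prec> y \<equiv> less_fun x y"

abbreviation lex_less_eq :: "(nat \<Rightarrow> nat) \<Rightarrow> (nat \<Rightarrow> nat) \<Rightarrow> bool"  (infix \<open>\<preceq>\<close> 50)
  where "x \<preceq> y \<equiv> less_fun x y \<or> x = y"

text \<open>On \<^term>\<open>seqs m\<close> with \<open>m \<ge> 1\<close> this is the ordinary convergent series. The unconditional sum is
  used because it is 0 for divergent series, so that the axioms of \<^locale>\<open>Metric_space\<close> which are
  not relativised to the carrier hold.\<close>

definition seq_dist :: "nat \<Rightarrow> (nat \<Rightarrow> nat) \<Rightarrow> (nat \<Rightarrow> nat) \<Rightarrow> real"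
  where "seq_dist m a b = (\<Sum>\<^sub>\<infinity>i. \<bar>real (a i) - real (b i)\<bar> / real (m + 1) ^ Suc i)"

definition seq_metric :: "nat \<Rightarrow> (nat \<Rightarrow> nat) metric"
  where "seq_metric m = metric (seqs m, seq_dist m)"

definition M2 :: "nat \<Rightarrow> (nat \<Rightarrow> nat) \<Rightarrow> (nat \<Rightarrow> nat) \<Rightarrow> (nat \<Rightarrow> nat) set"
  where "M2 m c d =
    {x \<in> seqs m. \<forall>n\<ge>1. c \<preceq> (shift ^^ n) x \<and> (shift ^^ n) x \<prec> x \<and> x \<preceq> d}"

definition M1 :: "nat \<Rightarrow> (nat \<Rightarrow> nat) \<Rightarrow> (nat \<Rightarrow> nat) set"
  where "M1 m c = {x \<in> seqs m. \<forall>n>0. (shift ^^ n) x \<prec> x \<and> x \<preceq> c}"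

definition N1 :: "nat \<Rightarrow> (nat \<Rightarrow> nat) \<Rightarrow> (nat \<Rightarrow> nat) set"
  where "N1 m c = {x \<in> seqs m. \<forall>n\<ge>1. c \<preceq> (shift ^^ n) x \<and> (shift ^^ n) x \<prec> x}"

section \<open>The metric is well defined and induces the product topology\<close>

lemma hausdorff_dim_empty: "hausdorff_dim X {} = 0"
proof -
  have "hausdorff_premeasure X 0 \<delta> {} = 0" if "\<delta> > 0" for \<delta>
  proof -
    have "(\<lambda>_. {}) \<in> mesh_covers X \<delta> {}"
      by (simp add: mesh_covers_def mdiam_def bot_ennreal)
    then have "hausdorff_premeasure X 0 \<delta> {} \<le> (\<Sum>i::nat. diam_powr X 0 {})"
      unfolding hausdorff_premeasure_def by (rule INF_lower)
    then show ?thesis by (simp add: diam_powr_def)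
  qed
  then have "hausdorff_measure X 0 {} = 0"
    by (simp add: hausdorff_measure_def)
  then have "hausdorff_dim X {} \<le> ennreal 0"
    unfolding hausdorff_dim_def by (intro Inf_lower imageI) simp
  then show ?thesis by simp
qed

lemma summable_bound:
  assumes "m \<ge> 1"
  shows "summable (\<lambda>i. real m / real (m + 1) ^ Suc i)"
proof -
  have "summable (\<lambda>i. (real m / real (m + 1)) * (1 / real (m + 1)) ^ i)"
    using assms by (intro summable_mult summable_geometric) auto
  then show ?thesis by (simp add: power_divide)
qed

lemma summable_seq_dist:
  assumes "m \<ge> 1" "a \<in> seqs m" "b \<in> seqs m"
  shows "summable (\<lambda>i. \<bar>real (a i) - real (b i)\<bar> / real (m + 1) ^ Suc i)"
proof (rule summable_comparison_test'[OF summable_bound[OF assms(1)], of 0])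
  fix i
  have "a i \<le> m" "b i \<le> m" using assms by (auto simp: seqs_def)
  then have "\<bar>real (a i) - real (b i)\<bar> \<le> real m" by linarith
  then show "norm (\<bar>real (a i) - real (b i)\<bar> / real (m + 1) ^ Suc i) \<le> real m / real (m + 1) ^ Suc i"
    by (auto intro!: divide_right_mono)
qed

lemma seq_dist_eq_suminf:
  assumes "m \<ge> 1" "a \<in> seqs m" "b \<in> seqs m"
  shows "seq_dist m a b = (\<Sum>i. \<bar>real (a i) - real (b i)\<bar> / real (m + 1) ^ Suc i)"
  unfolding seq_dist_def
  by (intro infsumI norm_summable_imp_has_sum summable_sums) (use summable_seq_dist[OF assms] in simp_all)

lemma seq_dist_lower:
  assumes "m \<ge> 1" "a \<in> seqs m" "b \<in> seqs m" "a i \<noteq> b i"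
  shows "1 / real (m + 1) ^ Suc i \<le> seq_dist m a b"
proof -
  have "1 \<le> \<bar>real (a i) - real (b i)\<bar>" using assms(4) by linarith
  then have "1 / real (m + 1) ^ Suc i \<le> \<bar>real (a i) - real (b i)\<bar> / real (m + 1) ^ Suc i"
    by (intro divide_right_mono) auto
  also have "\<dots> = (\<Sum>j\<in>{i}. \<bar>real (a j) - real (b j)\<bar> / real (m + 1) ^ Suc j)" by simp
  also have "\<dots> \<le> seq_dist m a b"
    unfolding seq_dist_eq_suminf[OF assms(1-3)] by (intro sum_le_suminf summable_seq_dist assms) auto
  finally show ?thesis .
qed

lemma seq_dist_upper:
  assumes "m \<ge> 1" "a \<in> seqs m" "b \<in> seqs m" "\<And>i. i < n \<Longrightarrow> a i = b i"
  shows "seq_dist m a b \<le> 1 / real (m + 1) ^ n"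
proof -
  let ?f = "\<lambda>i. \<bar>real (a i) - real (b i)\<bar> / real (m + 1) ^ Suc i"
  let ?g = "\<lambda>i. (real m / real (m + 1) ^ Suc n) * (1 / real (m + 1)) ^ i"
  have sg: "summable ?g"
    using assms(1) by (intro summable_mult summable_geometric) auto
  have sf: "summable (\<lambda>i. ?f (i + n))"
    using summable_seq_dist[OF assms(1-3)] by (subst summable_iff_shift)
  have "seq_dist m a b = (\<Sum>i. ?f (i + n)) + sum ?f {..<n}"
    unfolding seq_dist_eq_suminf[OF assms(1-3)] using summable_seq_dist[OF assms(1-3)] by (rule suminf_split_initial_segment)
  also have "sum ?f {..<n} = 0" using assms(4) by simp
  also have "(\<Sum>i. ?f (i + n)) + 0 \<le> (\<Sum>i. ?g i)"
  proof -
    have "?f (i + n) \<le> ?g i" for i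
    proof -
      have "a (i + n) \<le> m" "b (i + n) \<le> m" using assms by (auto simp: seqs_def)
      then have "\<bar>real (a (i + n)) - real (b (i + n))\<bar> \<le> real m" by linarith
      then have "?f (i + n) \<le> real m / real (m + 1) ^ Suc (i + n)"
        by (intro divide_right_mono) auto
      also have "\<dots> = ?g i" by (simp add: power_add power_divide)
      finally show ?thesis .
    qed
    then show ?thesis using suminf_le[OF _ sf sg] by simp
  qed
  also have "(\<Sum>i. ?g i) = (real m / real (m + 1) ^ Suc n) * (1 / (1 - 1 / real (m + 1)))"
    using assms(1) by (subst suminf_mult, intro summable_geometric, simp, subst suminf_geometric, auto)
  also have "1 - 1 / real (m + 1) = real m / real (m + 1)" by (simp add: field_simps)
  also have "(real m / real (m + 1) ^ Suc n) * (1 / (real m / real (m + 1))) = 1 / real (m + 1) ^ n"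
    using assms(1) by simp
  finally show ?thesis .
qed

lemma Metric_space_seqs:
  assumes m: "m \<ge> 1"
  shows "Metric_space (seqs m) (seq_dist m)"
proof
  fix x y :: "nat \<Rightarrow> nat"
  show "0 \<le> seq_dist m x y"
    unfolding seq_dist_def by (intro infsum_nonneg) auto
  show "seq_dist m x y = seq_dist m y x"
    unfolding seq_dist_def by (simp add: abs_minus_commute)
next
  fix x y assume xy: "x \<in> seqs m" "y \<in> seqs m"
  show "seq_dist m x y = 0 \<longleftrightarrow> x = y"
  proof
    assume 0: "seq_dist m x y = 0"
    have "x i = y i" for i
    proof (rule ccontr)
      assume "x i \<noteq> y i"
      from seq_dist_lower[OF m xy this] 0 have "1 / real (m + 1) ^ Suc i \<le> 0" by simp
      moreover have "0 < 1 / real (m + 1) ^ Suc i" by (intro divide_pos_pos zero_less_power) auto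
      ultimately show False by linarith
    qed
    then show "x = y" by blast
  qed (simp add: seq_dist_def)
next
  fix x y z assume xyz: "x \<in> seqs m" "y \<in> seqs m" "z \<in> seqs m"
  note s = summable_seq_dist[OF m xyz(1,2)] summable_seq_dist[OF m xyz(2,3)]
  have "seq_dist m x z \<le> (\<Sum>i. \<bar>real (x i) - real (y i)\<bar> / real (m + 1) ^ Suc i
      + \<bar>real (y i) - real (z i)\<bar> / real (m + 1) ^ Suc i)"
    unfolding seq_dist_eq_suminf[OF m xyz(1,3)]
  proof (rule suminf_le[OF _ summable_seq_dist[OF m xyz(1,3)] summable_add[OF s]])
    fix i
    show "\<bar>real (x i) - real (z i)\<bar> / real (m + 1) ^ Suc i
      \<le> \<bar>real (x i) - real (y i)\<bar> / real (m + 1) ^ Suc i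
        + \<bar>real (y i) - real (z i)\<bar> / real (m + 1) ^ Suc i"
      unfolding add_divide_distrib[symmetric] by (rule divide_right_mono) auto
  qed
  also have "\<dots> = seq_dist m x y + seq_dist m y z"
    unfolding seq_dist_eq_suminf[OF m xyz(1,2)] seq_dist_eq_suminf[OF m xyz(2,3)]
    by (rule suminf_add[OF s, symmetric])
  finally show "seq_dist m x z \<le> seq_dist m x y + seq_dist m y z" .
qed

lemma mspace_seq_metric [simp]: "m \<ge> 1 \<Longrightarrow> mspace (seq_metric m) = seqs m"
  and mdist_seq_metric [simp]: "m \<ge> 1 \<Longrightarrow> mdist (seq_metric m) = seq_dist m"
  by (simp_all add: seq_metric_def Metric_space.mspace_metric Metric_space.mdist_metric Metric_space_seqs)

lemma open_cylinder:
  fixes x :: "nat \<Rightarrow> nat"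
  shows "open {y. \<forall>i<n. y i = x i}"
proof -
  have "{y. \<forall>i<n. y i = x i} = (\<Inter>i\<in>{..<n}. (\<lambda>y. y i) -` {x i})" by auto
  also have "open \<dots>"
    by (intro open_INT ballI open_vimage continuous_on_product_coordinates)
       (auto simp: open_discrete)
  finally show ?thesis .
qed

lemma openin_seqs_iff:
  "openin (top_of_set (seqs m)) U \<longleftrightarrow>
    U \<subseteq> seqs m \<and> (\<forall>x\<in>U. \<exists>n. {y \<in> seqs m. \<forall>i<n. y i = x i} \<subseteq> U)"  (is "?L \<longleftrightarrow> ?R")
proof
  assume ?L
  then obtain T where T: "open T" "U = seqs m \<inter> T" by (auto simp: openin_open)
  have "\<exists>n. {y \<in> seqs m. \<forall>i<n. y i = x i} \<subseteq> U" if "x \<in> U" for x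
  proof -
    from T(1) have "openin (product_topology (\<lambda>_. euclidean) UNIV) T"
      by (simp add: open_fun_def)
    moreover have "x \<in> T" using that T by auto
    ultimately obtain X where X: "x \<in> (\<Pi>\<^sub>E i\<in>UNIV. X i)" "finite {i. X i \<noteq> UNIV}"
        "(\<Pi>\<^sub>E i\<in>UNIV. X i) \<subseteq> T"
      using product_topology_open_contains_basis[of "\<lambda>_. euclidean" UNIV T x] by auto
    obtain n where n: "{i. X i \<noteq> UNIV} \<subseteq> {..<n}"
      using X(2) finite_nat_iff_bounded by blast
    have "y \<in> T" if "\<forall>i<n. y i = x i" for y
    proof -
      have "y i \<in> X i" for i
        using that n X(1) by (cases "i < n") (auto simp: PiE_iff)
      then show ?thesis using X(3) by auto
    qed
    then show ?thesis using T(2) by blast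
  qed
  moreover have "U \<subseteq> seqs m" using T by auto
  ultimately show ?R by blast
next
  assume R: ?R
  show ?L
  proof (subst openin_subopen, intro ballI)
    fix x assume "x \<in> U"
    then obtain n where "{y \<in> seqs m. \<forall>i<n. y i = x i} \<subseteq> U" using R by blast
    moreover have "openin (top_of_set (seqs m)) (seqs m \<inter> {y. \<forall>i<n. y i = x i})"
      by (intro openin_open_Int open_cylinder)
    ultimately show "\<exists>T. openin (top_of_set (seqs m)) T \<and> x \<in> T \<and> T \<subseteq> U"
      using R \<open>x \<in> U\<close> by (intro exI[of _ "seqs m \<inter> {y. \<forall>i<n. y i = x i}"]) auto
  qed
qed

lemma mtopology_of_seq_metric:
  assumes m: "m \<ge> 1"
  shows "mtopology_of (seq_metric m) = top_of_set (seqs m)"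
proof -
  interpret Metric_space "seqs m" "seq_dist m" by (rule Metric_space_seqs[OF m])
  have "(\<exists>r>0. mball x r \<subseteq> U) \<longleftrightarrow> (\<exists>n. {y \<in> seqs m. \<forall>i<n. y i = x i} \<subseteq> U)"
    if x: "x \<in> seqs m" for x U
  proof
    assume "\<exists>r>0. mball x r \<subseteq> U"
    then obtain r where r: "r > 0" "mball x r \<subseteq> U" by blast
    have "1 / real (m + 1) < 1" using m by simp
    then obtain n where n: "(1 / real (m + 1)) ^ n < r"
      using real_arch_pow_inv[OF r(1)] by blast
    have "y \<in> mball x r" if y: "y \<in> seqs m" "\<forall>i<n. y i = x i" for y
      using seq_dist_upper[OF m x y(1), of n] y n x by (simp add: power_divide)
    then show "\<exists>n. {y \<in> seqs m. \<forall>i<n. y i = x i} \<subseteq> U" using r(2) by blast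
  next
    assume "\<exists>n. {y \<in> seqs m. \<forall>i<n. y i = x i} \<subseteq> U"
    then obtain n where n: "{y \<in> seqs m. \<forall>i<n. y i = x i} \<subseteq> U" by blast
    have "y i = x i" if y: "y \<in> mball x (1 / real (m + 1) ^ n)" "i < n" for y i
    proof (rule ccontr)
      assume "y i \<noteq> x i"
      then have "1 / real (m + 1) ^ Suc i \<le> seq_dist m x y"
        using y by (intro seq_dist_lower[OF m]) auto
      moreover have "1 / real (m + 1) ^ n \<le> 1 / real (m + 1) ^ Suc i"
        using y(2) by (intro divide_left_mono power_increasing) auto
      ultimately show False using y(1) by auto
    qed
    then have "mball x (1 / real (m + 1) ^ n) \<subseteq> U" using n by auto
    then show "\<exists>r>0. mball x r \<subseteq> U" by (intro exI[of _ "1 / real (m + 1) ^ n"]) auto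
  qed
  then have "openin mtopology U \<longleftrightarrow> openin (top_of_set (seqs m)) U" for U
    unfolding openin_seqs_iff openin_mtopology by (meson subsetD)
  then show ?thesis
    by (simp add: topology_eq seq_metric_def mtopology_of)
qed

end

theory Submission
  imports Defs "HOL-Probability.Infinite_Product_Measure"
begin

text \<open>
  Let \<open>B = m + 1\<close> and let \<open>A\<^sub>n(c, d)\<close> be the number of words of length \<open>n\<close> all of whose suffixes
  compare correctly with the corresponding prefixes of \<open>c\<close> and \<open>d\<close>. The dimension of \<open>M2 m c d\<close> is
  \<open>h / log B\<close>, where \<open>h = inf\<^sub>n (log A\<^sub>n) / n\<close> (and \<open>h = 0\<close> if some \<open>A\<^sub>n\<close> vanishes), and \<open>h\<close> depends
  continuously on \<open>(c, d)\<close>. Both facts come from one pair of estimates.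

  \<^bold>\<open>Upper estimate.\<close> If \<open>A\<^sub>n < B\<^sup>t\<^sup>n\<close> for one \<open>n \<ge> 1\<close>, then covering by the at most \<open>A\<^sub>n\<^sup>k\<close> cylinders of
  length \<open>nk\<close> shows that the dimension is at most \<open>t\<close> (\<open>hausdorff_dim_M2_le\<close>). Since \<open>A\<^sub>n\<close> only sees the
  first \<open>n\<close> entries of \<open>c\<close> and \<open>d\<close>, the same bound holds for all nearby pairs.

  \<^bold>\<open>Lower estimate.\<close> If \<open>A\<^sub>n \<ge> B\<^sup>t\<^sup>n\<close> for all \<open>n\<close> and \<open>0 < s < t\<close>, then the dimension is at least \<open>s\<close> for
  all pairs near \<open>(c, d)\<close> (\<open>hausdorff_dim_M2_ge\<close>). What may follow an admissible word depends only on
  its state: the sets of lengths of those suffixes that are prefixes of \<open>c\<close> and of \<open>d\<close>. There are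
  infinitely many states, but long matches carry no entropy: of all extensions of a word by \<open>N\<close>
  letters, only the lexicographically smallest one can end in a match with \<open>c\<close> of length at least \<open>N\<close>,
  and only the largest one in such a match with \<open>d\<close> (\<open>card_high_extensions\<close>). So paths that avoid the
  finitely many states with short matches grow at most like \<open>2\<^sup>n\<^sup>/\<^sup>N\<close>, and the growth must come from
  loops at one of these finitely many states: there are a state and a length \<open>n\<close> with more than about
  \<open>B\<^sup>s\<^sup>n\<close> loops (\<open>exists_many_loops\<close>). Loops can be concatenated freely, and because every concatenation
  returns to a state with short matches, it agrees with \<open>c\<close> and \<open>d\<close> only along bounded stretches.
  Hence it also lies strictly between \<open>c'\<close> and \<open>d'\<close> for \<open>c'\<close> near \<open>c\<close> and \<open>d'\<close> near \<open>d\<close>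
  (\<open>loop_sequence_between\<close>).

  The sequences in \<open>M2\<close> moreover have to exceed all their shifts. If \<open>b\<close> is the largest loop, then the
  largest shift of a concatenation of loops has the form \<open>s = u b b b \<dots>\<close> with a suffix \<open>u\<close> of a loop.
  Discard the at most \<open>n\<close> loops that are rotations of \<open>b\<close>. Then in a concatenation \<open>y\<close> of the remaining
  loops \<open>b b\<close> does not occur at any position, and \<open>u b b y\<close> follows the maximum \<open>s\<close> for longer than any of
  its shifts does (\<open>dominates_its_shifts\<close>). So \<open>M2 m c' d'\<close> contains a copy of a full shift on about \<open>B\<^sup>s\<^sup>n\<close>
  blocks of length \<open>n\<close>, which has dimension at least \<open>s\<close> by the mass distribution principle.
\<close>

section \<open>Counting words through loops\<close>

lemma power_ge_linear:
  fixes t :: real assumes "1 < t"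
  shows "real n \<le> 1 / (t - 1) * t ^ n"
  using Bernoulli_inequality[of "t - 1" n] assms by (simp add: field_simps)

text \<open>Pairs of positions in a word of length \<open>n\<close> can thus be paid for by an arbitrarily small increase
  of the growth rate.\<close>

lemma quadratic_times_power_le:
  fixes r q :: real assumes "0 < r" "r < q"
  shows "\<exists>K\<ge>0. \<forall>n. real (n + 1) ^ 2 * r ^ n \<le> K * q ^ n"
proof -
  \<comment> \<open>One factor \<open>t\<^sup>n\<close> for each of the two linear factors.\<close>
  define t where "t = sqrt (q / r)"
  have t: "1 < t" "t ^ 2 * r = q" using assms by (auto simp: t_def)
  define K where "K = t / (t - 1)"
  have K: "0 \<le> K" using t by (simp add: K_def)
  have "real (n + 1) ^ 2 * r ^ n \<le> K ^ 2 * q ^ n" for n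
  proof -
    have "real (n + 1) \<le> K * t ^ n"
      using power_ge_linear[OF t(1), of "Suc n"] by (simp add: K_def)
    then have "real (n + 1) ^ 2 * r ^ n \<le> (K * t ^ n) ^ 2 * r ^ n"
      using assms by (intro mult_right_mono power_mono) auto
    also have "\<dots> = K ^ 2 * (t ^ 2 * r) ^ n" by (simp add: power_mult_distrib power_mult[symmetric] mult.commute)
    finally show ?thesis using t by simp
  qed
  then show ?thesis using K by (intro exI[of _ "K ^ 2"]) auto
qed

text \<open>A deterministic automaton, possibly with infinitely many states, given by the words that it
  accepts and by the state \<open>st w\<close> that it reaches on \<open>w\<close>.\<close>

locale congruent_language =
  fixes adm :: "'a list \<Rightarrow> bool" and st :: "'a list \<Rightarrow> 'q"
  assumes adm_prefix: "adm (u @ z) \<Longrightarrow> adm u"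
    and finite_adm: "finite {w. adm w \<and> length w = n}"
    and adm_cong: "adm u \<Longrightarrow> adm u' \<Longrightarrow> st u = st u' \<Longrightarrow> adm (u @ z) \<Longrightarrow> adm (u' @ z)"
    and st_cong: "st u = st u' \<Longrightarrow> st (u @ z) = st (u' @ z)"
begin

text \<open>The states are restricted strictly between the end points only, so that a path can be cut at its
  visits to a forbidden state and the pieces are again paths of the same kind.\<close>

definition paths :: "'a list \<Rightarrow> 'q set \<Rightarrow> nat \<Rightarrow> 'a list set" where
  "paths w U n = {z. length z = n \<and> adm (w @ z) \<and> (\<forall>k. 0 < k \<and> k < n \<longrightarrow> st (w @ take k z) \<in> U)}"

definition loops :: "'a list \<Rightarrow> nat \<Rightarrow> 'a list set" where
  "loops w n = {z. length z = n \<and> adm (w @ z) \<and> st (w @ z) = st w}"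

lemma finite_extensions: "finite {z. length z = n \<and> adm (w @ z)}"
proof (rule finite_imageD)
  show "finite ((@) w ` {z. length z = n \<and> adm (w @ z)})"
    by (rule finite_subset[OF _ finite_adm[of "length w + n"]]) auto
qed (auto simp: inj_on_def)

lemma finite_paths: "finite (paths w U n)"
  by (rule finite_subset[OF _ finite_extensions[of n w]]) (auto simp: paths_def)

lemma finite_loops: "finite (loops w n)"
  by (rule finite_subset[OF _ finite_extensions[of n w]]) (auto simp: loops_def)

text \<open>A path through \<open>v\<close> is cut at its first and its last visit to \<open>v\<close>: the outer pieces avoid \<open>v\<close>, the
  middle one is a loop. By congruence, loops and final pieces may be read off any word \<open>w0\<close> that
  reaches \<open>v\<close>, which makes the three pieces independent of each other.\<close>

lemma paths_insert_subset:
  assumes w0: "adm w0" "st w0 = v"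
  shows "paths w (insert v U) n \<subseteq> paths w U n \<union>
    (\<Union>(i, j)\<in>{..n} \<times> {..n}. (\<lambda>(x, y, z). x @ y @ z) `
       (if i + j \<le> n then paths w U i \<times> loops w0 j \<times> paths w0 U (n - i - j) else {}))"
proof
  fix z assume z: "z \<in> paths w (insert v U) n"
  then have len: "length z = n" and az: "adm (w @ z)"
    and int: "\<And>k. 0 < k \<Longrightarrow> k < n \<Longrightarrow> st (w @ take k z) \<in> insert v U"
    by (auto simp: paths_def)
  define K where "K = {k. 0 < k \<and> k < n \<and> st (w @ take k z) = v}"
  have finK: "finite K" by (rule finite_subset[of _ "{..n}"]) (auto simp: K_def)
  show "z \<in> paths w U n \<union>
    (\<Union>(i, j)\<in>{..n} \<times> {..n}. (\<lambda>(x, y, z). x @ y @ z) `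
       (if i + j \<le> n then paths w U i \<times> loops w0 j \<times> paths w0 U (n - i - j) else {}))"
  proof (cases "K = {}")
    case True
    then have "z \<in> paths w U n" using len az int unfolding K_def paths_def by blast
    then show ?thesis ..
  next
    case False
    define i where "i = Min K"
    define l where "l = Max K"
    have "i \<in> K" "l \<in> K" using finK False by (auto simp: i_def l_def)
    have il: "i \<le> l" using finK \<open>i \<in> K\<close> by (auto simp: l_def)
    have i: "0 < i" "i < n" "st (w @ take i z) = v" using \<open>i \<in> K\<close> by (auto simp: K_def)
    have l: "0 < l" "l < n" "st (w @ take l z) = v" using \<open>l \<in> K\<close> by (auto simp: K_def)
    have adm_take: "adm (w @ take k z)" for k
      using az adm_prefix[of "w @ take k z" "drop k z"] by simp
    have below: "st (w @ take k z) \<in> U" if "0 < k" "k < i" for k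
    proof -
      have "k \<notin> K" using that(2) Min_le[OF finK] unfolding i_def by (metis leD)
      then have "st (w @ take k z) \<noteq> v" using that i(2) unfolding K_def by simp
      moreover have "st (w @ take k z) \<in> insert v U" using that i(2) by (intro int) simp_all
      ultimately show ?thesis by simp
    qed
    have above: "st (w @ take k z) \<in> U" if "l < k" "k < n" for k
    proof -
      have "k \<notin> K" using that(1) Max_ge[OF finK] unfolding l_def by (metis leD)
      then have "st (w @ take k z) \<noteq> v" using that unfolding K_def by simp
      moreover have "st (w @ take k z) \<in> insert v U" using that by (intro int) simp_all
      ultimately show ?thesis by simp
    qed
    have x: "take i z \<in> paths w U i"
      unfolding paths_def using i(2) len adm_take[of i] below by simp
    define y where "y = drop i (take l z)"
    have take_l: "take l z = take i z @ y"
      using il by (metis append_take_drop_id min.absorb1 take_take y_def)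
    have y: "y \<in> loops w0 (l - i)"
    proof -
      have "adm (w0 @ y)"
        using adm_cong[of "w @ take i z" w0 y] adm_take[of i] adm_take[of l] w0 i take_l by simp
      moreover have "st (w0 @ y) = st w0"
        using st_cong[of "w @ take i z" w0 y] w0 i l take_l by simp
      moreover have "length y = l - i" using len l by (simp add: y_def)
      ultimately show ?thesis by (simp add: loops_def)
    qed
    have t: "drop l z \<in> paths w0 U (n - l)"
    proof -
      have "adm (w0 @ drop l z)"
        using adm_cong[of "w @ take l z" w0 "drop l z"] adm_take[of l] az w0 l by simp
      moreover have "st (w0 @ take k (drop l z)) \<in> U" if "0 < k" "k < n - l" for k
      proof -
        have "st (w0 @ take k (drop l z)) = st ((w @ take l z) @ take k (drop l z))"
          using l w0 by (intro st_cong) simp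
        also have "(w @ take l z) @ take k (drop l z) = w @ take (l + k) z"
          by (simp add: take_add)
        finally show ?thesis using above[of "l + k"] that by simp
      qed
      ultimately show ?thesis using len by (simp add: paths_def)
    qed
    have "z = take i z @ y @ drop l z"
      using take_l by (metis append.assoc append_take_drop_id)
    moreover have "i + (l - i) \<le> n" "n - i - (l - i) = n - l" using il l by auto
    ultimately have "z \<in> (\<lambda>(x, y, z). x @ y @ z) ` (if i + (l - i) \<le> n
        then paths w U i \<times> loops w0 (l - i) \<times> paths w0 U (n - i - (l - i)) else {})"
      using x y t by (force simp: image_iff)
    moreover have "(i, l - i) \<in> {..n} \<times> {..n}" using i l by auto
    ultimately show ?thesis by blast
  qed
qed

lemma card_paths_insert:
  fixes q :: real
  assumes P: "\<And>w n. adm w \<Longrightarrow> card (paths w U n) \<le> C * q ^ n"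
    and L: "\<And>n. card (loops w0 n) \<le> D * q ^ n"
    and pos: "0 \<le> C" "0 \<le> D" "0 \<le> q" and w0: "adm w0" "st w0 = v" and w: "adm w"
  shows "card (paths w (insert v U) n) \<le> C * q ^ n + real (n + 1) ^ 2 * (C * D * C * q ^ n)"
proof -
  define Q where "Q = (\<lambda>(i, j). (\<lambda>(x, y, z). x @ y @ z) `
       (if i + j \<le> n then paths w U i \<times> loops w0 j \<times> paths w0 U (n - i - j) else {}))"
  have fin: "finite (Q p)" for p
    by (cases p) (auto simp: Q_def intro!: finite_imageI finite_cartesian_product finite_paths finite_loops)
  have Q: "real (card (Q p)) \<le> C * D * C * q ^ n" for p
  proof -
    obtain i j where p: "p = (i, j)" by (cases p)
    show ?thesis
    proof (cases "i + j \<le> n")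
      case True
      have "card (Q p) \<le> card (paths w U i \<times> loops w0 j \<times> paths w0 U (n - i - j))"
        using True unfolding p Q_def
        by (auto intro!: card_image_le finite_cartesian_product finite_paths finite_loops)
      also have "\<dots> = card (paths w U i) * (card (loops w0 j) * card (paths w0 U (n - i - j)))"
        by (simp add: card_cartesian_product)
      finally have "real (card (Q p)) \<le>
          real (card (paths w U i)) * (real (card (loops w0 j)) * real (card (paths w0 U (n - i - j))))"
        by (metis of_nat_le_iff of_nat_mult)
      also have "\<dots> \<le> (C * q ^ i) * ((D * q ^ j) * (C * q ^ (n - i - j)))"
        using pos by (intro mult_mono P L w w0 mult_nonneg_nonneg) auto
      also have "\<dots> = C * D * C * q ^ (i + (j + (n - i - j)))" by (simp only: power_add ac_simps)
      also have "i + (j + (n - i - j)) = n" using True by simp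
      finally show ?thesis .
    qed (use pos in \<open>auto simp: p Q_def\<close>)
  qed
  have "card (paths w (insert v U) n) \<le> card (paths w U n \<union> (\<Union>p\<in>{..n} \<times> {..n}. Q p))"
    using paths_insert_subset[OF w0, of w U n] fin unfolding Q_def[symmetric]
    by (intro card_mono finite_UnI finite_paths finite_UN_I finite_cartesian_product) auto
  also have "\<dots> \<le> card (paths w U n) + (\<Sum>p\<in>{..n} \<times> {..n}. card (Q p))"
    by (intro card_Un_le[THEN order_trans] add_mono card_UN_le) auto
  finally have "real (card (paths w (insert v U) n))
      \<le> real (card (paths w U n)) + (\<Sum>p\<in>{..n} \<times> {..n}. real (card (Q p)))"
    by (metis of_nat_le_iff of_nat_add of_nat_sum)
  also have "\<dots> \<le> C * q ^ n + (\<Sum>p\<in>{..n} \<times> {..n}. C * D * C * q ^ n)"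
    by (intro add_mono P w sum_mono Q)
  also have "\<dots> = C * q ^ n + real (n + 1) ^ 2 * (C * D * C * q ^ n)"
    by (simp add: card_cartesian_product power2_eq_square algebra_simps)
  finally show ?thesis .
qed

text \<open>The states of \<open>E\<close> are allowed one after the other. Each of them costs a factor that is quadratic
  in the length, hence an arbitrarily small increase of the growth rate.\<close>

lemma card_paths_growth:
  fixes r q :: real
  assumes "finite E" and r: "0 < r" "r < q" and C0: "0 \<le> C0" and D: "0 \<le> D"
    and high: "\<And>w n. adm w \<Longrightarrow> card (paths w H n) \<le> C0 * r ^ n"
    and low: "\<And>w n. adm w \<Longrightarrow> st w \<in> E \<Longrightarrow> card (loops w n) \<le> D * r ^ n"
  shows "\<exists>C\<ge>0. \<forall>w n. adm w \<longrightarrow> card (paths w (E \<union> H) n) \<le> C * q ^ n"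
  using assms(1) r(2) low
proof (induction E arbitrary: q rule: finite_induct)
  case empty
  have "C0 * r ^ n \<le> C0 * q ^ n" for n
    using empty r C0 by (intro mult_left_mono power_mono) auto
  then have "card (paths w ({} \<union> H) n) \<le> C0 * q ^ n" if "adm w" for w n
    using high[OF that, of n] by (simp add: order_trans)
  then show ?case using C0 by blast
next
  case (insert v E)
  obtain p where p: "r < p" "p < q" using dense insert.prems(1) by blast
  then obtain C where C: "0 \<le> C" "\<And>w n. adm w \<Longrightarrow> card (paths w (E \<union> H) n) \<le> C * p ^ n"
    using insert.IH[OF p(1) insert.prems(2)] by blast
  show ?case
  proof (cases "\<exists>w0. adm w0 \<and> st w0 = v")
    case False
    have sub: "paths w (insert v E \<union> H) n \<subseteq> paths w (E \<union> H) n" for w n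
    proof
      fix z assume z: "z \<in> paths w (insert v E \<union> H) n"
      have "st (w @ take k z) \<noteq> v" for k
      proof -
        have "adm ((w @ take k z) @ drop k z)" using z by (simp add: paths_def)
        then show ?thesis using False adm_prefix by blast
      qed
      then show "z \<in> paths w (E \<union> H) n" using z by (auto simp: paths_def)
    qed
    have "C * p ^ n \<le> C * q ^ n" for n
      using p r C by (intro mult_left_mono power_mono) auto
    then have "card (paths w (insert v E \<union> H) n) \<le> C * q ^ n" if "adm w" for w n
      using C(2)[OF that, of n] card_mono[OF finite_paths sub[of w n]] by (meson of_nat_mono order_trans)
    then show ?thesis using C(1) by blast
  next
    case True
    then obtain w0 where w0: "adm w0" "st w0 = v" by blast
    obtain K where K: "0 \<le> K" "\<And>n. real (n + 1) ^ 2 * p ^ n \<le> K * q ^ n"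
      using quadratic_times_power_le[of p q] p r by auto
    have L: "card (loops w0 n) \<le> D * p ^ n" for n
    proof -
      have "card (loops w0 n) \<le> D * r ^ n" using insert.prems(2) w0 by simp
      also have "\<dots> \<le> D * p ^ n" using p r D by (intro mult_left_mono power_mono) auto
      finally show ?thesis .
    qed
    have "card (paths w (insert v E \<union> H) n) \<le> (C + C * D * C * K) * q ^ n" if w: "adm w" for w n
    proof -
      have "card (paths w (insert v (E \<union> H)) n) \<le> C * p ^ n + real (n + 1) ^ 2 * (C * D * C * p ^ n)"
        using C L w0 w D p r by (intro card_paths_insert[where ?w0.0 = w0]) auto
      also have "\<dots> = C * p ^ n + C * D * C * (real (n + 1) ^ 2 * p ^ n)" by (simp only: ac_simps)
      also have "\<dots> \<le> C * q ^ n + C * D * C * (K * q ^ n)"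
        using C D p r by (intro add_mono mult_left_mono power_mono K mult_nonneg_nonneg) auto
      finally show ?thesis by (simp add: algebra_simps)
    qed
    then show ?thesis using C(1) D K(1)
      by (intro exI[of _ "C + C * D * C * K"]) (auto intro!: add_nonneg_nonneg mult_nonneg_nonneg)
  qed
qed

text \<open>If the paths that avoid the finite set \<open>E\<close> grow more slowly than the whole language, then the
  growth is due to loops at a single state in \<open>E\<close>. The constant \<open>D\<close> leaves room to discard some loops.\<close>

lemma many_loops:
  fixes r \<rho> :: real
  assumes E: "finite E" and r: "0 < r" "r < \<rho>" and C0: "0 \<le> C0"
    and high: "\<And>w n. adm w \<Longrightarrow> card (paths w (- E) n) \<le> C0 * r ^ n"
    and nil: "adm []"
    and growth: "\<And>n. \<rho> ^ n \<le> card {w. adm w \<and> length w = n}" and D: "0 \<le> D"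
  shows "\<exists>w n. adm w \<and> st w \<in> E \<and> D * r ^ n < card (loops w n)"
proof (rule ccontr)
  assume no: "\<not> ?thesis"
  have low: "card (loops w n) \<le> D * r ^ n" if "adm w" "st w \<in> E" for w n
  proof (rule ccontr)
    assume "\<not> ?thesis"
    then have "D * r ^ n < card (loops w n)" by simp
    then show False using no that by blast
  qed
  obtain q where q: "r < q" "q < \<rho>" using dense r by blast
  obtain C where C: "0 \<le> C" "\<And>w n. adm w \<Longrightarrow> card (paths w (E \<union> - E) n) \<le> C * q ^ n"
    using card_paths_growth[OF E r(1) q(1) C0 D high low] by blast
  have all: "paths [] (E \<union> - E) n = {w. adm w \<and> length w = n}" for n
    by (auto simp: paths_def)
  have bound: "(\<rho> / q) ^ n \<le> C" for n
  proof -
    have "\<rho> ^ n \<le> C * q ^ n" using growth[of n] C(2)[OF nil, of n] unfolding all by linarith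
    then show ?thesis using q r by (simp add: power_divide field_simps)
  qed
  have "1 < \<rho> / q" using q r by simp
  then obtain n where "C < (\<rho> / q) ^ n" using real_arch_pow by blast
  then show False using bound[of n] by simp
qed

end

section \<open>Words between two sequences\<close>

text \<open>No factor of \<open>w\<close> leaves \<open>c\<close> for the first time in the direction \<open>R\<close>: with \<open>(<)\<close> for \<open>R\<close> the sequence
  \<open>c\<close> is a lower bound, with \<open>(>)\<close> an upper bound. Only as many entries of \<open>c\<close> matter as \<open>w\<close> has letters.\<close>

definition obeys :: "(nat \<Rightarrow> nat \<Rightarrow> bool) \<Rightarrow> (nat \<Rightarrow> nat) \<Rightarrow> nat list \<Rightarrow> bool" where
  "obeys R c w \<longleftrightarrow> (\<forall>k j. k + j < length w \<longrightarrow> (\<forall>i<j. w ! (k + i) = c i) \<longrightarrow> \<not> R (w ! (k + j)) (c j))"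

definition matches :: "(nat \<Rightarrow> nat) \<Rightarrow> nat list \<Rightarrow> nat set" where
  "matches c w = {a. a \<le> length w \<and> (\<forall>i<a. w ! (length w - a + i) = c i)}"

lemma obeys_prefix:
  assumes "obeys R c (u @ z)" shows "obeys R c u"
  unfolding obeys_def
proof (intro allI impI)
  fix k j assume "k + j < length u" "\<forall>i<j. u ! (k + i) = c i"
  then show "\<not> R (u ! (k + j)) (c j)"
    using assms[unfolded obeys_def, rule_format, of k j] by (simp add: nth_append)
qed

lemma obeys_suffix:
  assumes "obeys R c (u @ z)" shows "obeys R c z"
  unfolding obeys_def
proof (intro allI impI)
  fix k j assume "k + j < length z" "\<forall>i<j. z ! (k + i) = c i"
  then show "\<not> R (z ! (k + j)) (c j)"
    using assms[unfolded obeys_def, rule_format, of "length u + k" j] by (simp add: nth_append add.assoc)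
qed

lemma nth_append_from_end:
  assumes "a \<le> length u" "i < a"
  shows "(u @ z) ! (length u - a + i) = u ! (length u - a + i)"
proof -
  have "length u - a + i < length u" using assms by linarith
  then show ?thesis by (simp only: nth_append if_True)
qed

lemma obeys_append_matches:
  assumes "obeys R c (u @ z)" "a \<in> matches c u" "j < length z" "\<And>i. i < j \<Longrightarrow> z ! i = c (a + i)"
  shows "\<not> R (z ! j) (c (a + j))"
proof -
  have a: "a \<le> length u" "\<And>i. i < a \<Longrightarrow> u ! (length u - a + i) = c i"
    using assms(2) by (auto simp: matches_def)
  have "(u @ z) ! (length u - a + i) = c i" if "i < a + j" for i
  proof (cases "i < a")
    case True
    then show ?thesis using a by (simp only: nth_append_from_end)
  next
    case False
    then obtain i' where "i = a + i'" using le_Suc_ex by (metis not_le)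
    then show ?thesis using assms(4)[of i'] that a by (simp add: nth_append)
  qed
  then have "\<not> R ((u @ z) ! (length u - a + (a + j))) (c (a + j))"
    using assms(1)[unfolded obeys_def, rule_format, of "length u - a" "a + j"] assms(3) a by simp
  then show ?thesis using a by (simp add: nth_append)
qed

text \<open>The restriction that \<open>u\<close> imposes on its continuations depends on \<open>u\<close> only through \<open>matches c u\<close>:
  any other suffix of \<open>u\<close> has already left \<open>c\<close> in the permitted direction.\<close>

lemma obeys_append_iff:
  "obeys R c (u @ z) \<longleftrightarrow> obeys R c u \<and> obeys R c z \<and>
     (\<forall>a\<in>matches c u. \<forall>j<length z. (\<forall>i<j. z ! i = c (a + i)) \<longrightarrow> \<not> R (z ! j) (c (a + j)))"
  (is "?L \<longleftrightarrow> ?R")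
proof
  assume ?L
  then show ?R using obeys_prefix obeys_suffix obeys_append_matches by blast
next
  assume r: ?R
  show ?L
    unfolding obeys_def
  proof (intro allI impI)
    fix k j assume kj: "k + j < length (u @ z)" and eq: "\<forall>i<j. (u @ z) ! (k + i) = c i"
    consider "k + j < length u" | "length u \<le> k" | "k < length u" "length u \<le> k + j" by linarith
    then show "\<not> R ((u @ z) ! (k + j)) (c j)"
    proof cases
      case 1
      then have "\<forall>i<j. u ! (k + i) = c i" using eq by (simp add: nth_append)
      with r 1 have "\<not> R (u ! (k + j)) (c j)" unfolding obeys_def by blast
      then show ?thesis using 1 by (simp add: nth_append)
    next
      case 2
      then obtain k' where k': "k = length u + k'" using le_Suc_ex by blast
      then have "\<forall>i<j. z ! (k' + i) = c i" "k' + j < length z" using eq kj by (auto simp: nth_append add.assoc)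
      with r have "\<not> R (z ! (k' + j)) (c j)" unfolding obeys_def by blast
      then show ?thesis by (simp add: nth_append k' add.assoc)
    next
      case 3
      define a where "a = length u - k"
      have "a \<le> j" using 3 unfolding a_def by linarith
      then obtain j' where j': "j = a + j'" using le_Suc_ex by blast
      have au: "a \<le> length u" "k = length u - a" using 3 by (auto simp: a_def)
      have "a \<in> matches c u"
        unfolding matches_def
      proof (intro CollectI conjI allI impI au(1))
        fix i assume "i < a"
        then show "u ! (length u - a + i) = c i"
          using eq[rule_format, of i] j' nth_append_from_end[OF au(1), of i z] unfolding au(2) by simp
      qed
      moreover have "z ! i = c (a + i)" if "i < j'" for i
        using eq[rule_format, of "a + i"] that j' au 3 by (simp add: nth_append)
      moreover have "j' < length z" using kj j' au 3 by simp
      ultimately have "\<not> R (z ! j') (c (a + j'))" using r by blast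
      then show ?thesis using au j' 3 by (simp add: nth_append)
    qed
  qed
qed

lemma matches_append:
  "matches c (u @ z) = matches c z \<union>
     {a + length z |a. a \<in> matches c u \<and> (\<forall>i<length z. z ! i = c (a + i))}" (is "?L = ?R")
proof (rule set_eqI)
  fix b
  show "b \<in> ?L \<longleftrightarrow> b \<in> ?R"
  proof (cases "b \<le> length z")
    case True
    have "(u @ z) ! (length (u @ z) - b + i) = z ! (length z - b + i)" for i
    proof -
      have "\<not> length (u @ z) - b + i < length u" "length (u @ z) - b + i - length u = length z - b + i"
        using True by auto
      then show ?thesis by (simp only: nth_append if_False)
    qed
    then have "b \<in> ?L \<longleftrightarrow> b \<in> matches c z" using True by (simp add: matches_def)
    moreover have "b \<in> matches c z" if "b \<in> {a + length z |a. a \<in> matches c u \<and> (\<forall>i<length z. z ! i = c (a + i))}"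
      using that True by (auto simp: matches_def)
    ultimately show ?thesis by blast
  next
    case False
    then obtain a where a: "b = a + length z" by (metis add.commute le_Suc_ex nat_le_linear)
    have "b \<in> ?L \<longleftrightarrow> a \<le> length u \<and> (\<forall>i<a + length z. (u @ z) ! (length u - a + i) = c i)"
      by (simp add: matches_def a)
    also have "\<dots> \<longleftrightarrow> a \<in> matches c u \<and> (\<forall>i<length z. z ! i = c (a + i))" (is "?A \<longleftrightarrow> ?B")
    proof
      assume A: ?A
      have "u ! (length u - a + i) = c i" if "i < a" for i
        using A that nth_append_from_end[of a u i z] by (metis trans_less_add1)
      moreover have "z ! i = c (a + i)" if "i < length z" for i
        using A that by (auto simp: nth_append dest!: spec[of _ "a + i"])
      ultimately show ?B using A by (simp add: matches_def)
    next
      assume B: ?B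
      have "(u @ z) ! (length u - a + i) = c i" if "i < a + length z" for i
      proof (cases "i < a")
        case True
        then have "a \<le> length u" "u ! (length u - a + i) = c i"
          using B True unfolding matches_def by blast+
        then show ?thesis using True by (simp only: nth_append_from_end)
      next
        case False
        then obtain i' where "i = a + i'" using le_Suc_ex by (metis not_le)
        then show ?thesis using B that by (simp add: matches_def nth_append)
      qed
      then show ?A using B by (simp add: matches_def)
    qed
    also have "\<dots> \<longleftrightarrow> b \<in> ?R" using False by (auto simp: a matches_def)
    finally show ?thesis .
  qed
qed

definition adm :: "nat \<Rightarrow> (nat \<Rightarrow> nat) \<Rightarrow> (nat \<Rightarrow> nat) \<Rightarrow> nat list \<Rightarrow> bool" where
  "adm m c d w \<longleftrightarrow> set w \<subseteq> {..m} \<and> obeys (<) c w \<and> obeys (>) d w"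

definition words :: "nat \<Rightarrow> (nat \<Rightarrow> nat) \<Rightarrow> (nat \<Rightarrow> nat) \<Rightarrow> nat \<Rightarrow> nat list set" where
  "words m c d n = {w. adm m c d w \<and> length w = n}"

lemma finite_words: "finite (words m c d n)"
  by (rule finite_subset[OF _ finite_lists_length_eq[of "{..m}" n]]) (auto simp: words_def adm_def)

lemma words_0: "words m c d 0 = {[]}"
  by (auto simp: words_def adm_def obeys_def)

lemma adm_suffix: "adm m c d (u @ z) \<Longrightarrow> adm m c d z"
  by (auto simp: adm_def dest: obeys_suffix)

lemma card_words_le: "card (words m c d n) \<le> (m + 1) ^ n"
proof -
  have "card (words m c d n) \<le> card {xs. set xs \<subseteq> {..m} \<and> length xs = n}"
    by (intro card_mono finite_lists_length_eq) (auto simp: words_def adm_def)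
  then show ?thesis by (simp add: card_lists_length_eq)
qed

text \<open>The state of a word records all suffixes that are still undecided with respect to one of the two
  bounds. By \<open>obeys_append_iff\<close> and \<open>matches_append\<close> it determines the possible continuations and
  their states.\<close>

definition match_state :: "(nat \<Rightarrow> nat) \<Rightarrow> (nat \<Rightarrow> nat) \<Rightarrow> nat list \<Rightarrow> nat set \<times> nat set" where
  "match_state c d w = (matches c w, matches d w)"

interpretation Lex: congruent_language "adm m c d" "match_state c d" for m c d
proof
  show "adm m c d (u @ z) \<Longrightarrow> adm m c d u" for u z
    by (auto simp: adm_def dest: obeys_prefix)
  show "finite {w. adm m c d w \<and> length w = n}" for n
    using finite_words[of m c d n] by (simp add: words_def)
  show "match_state c d u = match_state c d u' \<Longrightarrow> match_state c d (u @ z) = match_state c d (u' @ z)" for u u' z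
    by (simp add: match_state_def matches_append)
  show "adm m c d u \<Longrightarrow> adm m c d u' \<Longrightarrow> match_state c d u = match_state c d u' \<Longrightarrow>
    adm m c d (u @ z) \<Longrightarrow> adm m c d (u' @ z)" for u u' z
    by (simp add: adm_def match_state_def obeys_append_iff)
qed

lemma first_difference:
  fixes z z' :: "'a list"
  assumes "length z = length z'" "z \<noteq> z'"
  obtains j where "j < length z" "z ! j \<noteq> z' ! j" "\<And>i. i < j \<Longrightarrow> z ! i = z' ! i"
proof -
  have "\<exists>j. j < length z \<and> z ! j \<noteq> z' ! j" using assms nth_equalityI by blast
  then obtain j where "j < length z \<and> z ! j \<noteq> z' ! j" "\<And>i. i < j \<Longrightarrow> \<not> (i < length z \<and> z ! i \<noteq> z' ! i)"
    using exists_least_iff[of "\<lambda>j. j < length z \<and> z ! j \<noteq> z' ! j"] by blast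
  then show ?thesis using that by (metis order_less_trans)
qed

text \<open>If some extension lies strictly on the forbidden side of \<open>z'\<close>, then \<open>z'\<close> cannot consist of entries
  of \<open>c\<close> continuing a match: the other extension would have left \<open>c\<close> in the forbidden direction.\<close>

lemma matches_short:
  assumes "obeys R c (w @ z)" "length z' = length z" "j < length z"
    and "R (z ! j) (z' ! j)" "\<And>i. i < j \<Longrightarrow> z ! i = z' ! i"
  shows "matches c (w @ z') \<subseteq> {..<length z}"
proof (rule ccontr)
  assume "\<not> ?thesis"
  then obtain b where b: "b \<in> matches c (w @ z')" "length z \<le> b" by force
  then obtain a where a: "a \<in> matches c w" "\<forall>i<length z. z' ! i = c (a + i)"
  proof -
    have "b \<in> matches c z' \<or> (\<exists>a. a \<in> matches c w \<and> (\<forall>i<length z'. z' ! i = c (a + i)))"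
      using b(1) unfolding matches_append by blast
    then show thesis
    proof
      assume "b \<in> matches c z'"
      then have "\<forall>i<length z. z' ! i = c (0 + i)" using b(2) assms(2) by (auto simp: matches_def)
      moreover have "0 \<in> matches c w" by (simp add: matches_def)
      ultimately show thesis using that by blast
    qed (use that assms(2) in auto)
  qed
  have "\<not> R (z ! j) (c (a + j))"
    using a assms by (intro obeys_append_matches[OF assms(1)]) auto
  then show False using a assms by simp
qed

lemma long_match_unique:
  assumes R: "\<And>x y :: nat. x \<noteq> y \<Longrightarrow> R x y \<or> R y x"
    and z: "length z = n" "obeys R c (w @ z)" "\<not> matches c (w @ z) \<subseteq> {..<n}"
    and z': "length z' = n" "obeys R c (w @ z')" "\<not> matches c (w @ z') \<subseteq> {..<n}"
  shows "z = z'"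
proof (rule ccontr)
  assume "z \<noteq> z'"
  then obtain j where j: "j < length z" "z ! j \<noteq> z' ! j" "\<And>i. i < j \<Longrightarrow> z ! i = z' ! i"
    using z z' first_difference[of z z'] by auto
  from R[OF j(2)] show False
    using matches_short[of R c w z z' j] matches_short[of R c w z' z j] z z' j by auto
qed

definition low_states :: "nat \<Rightarrow> (nat set \<times> nat set) set" where
  "low_states N = Pow {..<N} \<times> Pow {..<N}"

text \<open>One exceptional extension for each of the two bounds: the smallest and the largest one.\<close>

lemma card_high_extensions:
  "card {z. length z = N \<and> adm m c d (w @ z) \<and> match_state c d (w @ z) \<notin> low_states N} \<le> 2" (is "card ?X \<le> 2")
proof -
  define Y where "Y R e = {z. length z = N \<and> obeys R e (w @ z) \<and> \<not> matches e (w @ z) \<subseteq> {..<N}}" for R e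
  have fin: "finite (?X \<inter> Y R e)" for R e
    by (rule finite_subset[OF _ Lex.finite_extensions[of N m c d w]]) auto
  have Y: "card (?X \<inter> Y R e) \<le> 1" if "\<And>x y :: nat. x \<noteq> y \<Longrightarrow> R x y \<or> R y x" for R e
    using fin[of R e] long_match_unique[OF that, where c = e and w = w and n = N]
    by (intro card_le_Suc0_iff_eq[THEN iffD2, unfolded One_nat_def[symmetric]]) (auto simp: Y_def)
  have "?X \<subseteq> (?X \<inter> Y (<) c) \<union> (?X \<inter> Y (>) d)"
    by (auto simp: Y_def low_states_def match_state_def adm_def)
  then have "card ?X \<le> card ((?X \<inter> Y (<) c) \<union> (?X \<inter> Y (>) d))"
    by (intro card_mono finite_UnI fin)
  also have "\<dots> \<le> card (?X \<inter> Y (<) c) + card (?X \<inter> Y (>) d)" by (rule card_Un_le)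
  also have "\<dots> \<le> 1 + 1" by (intro add_mono Y) auto
  finally show ?thesis by simp
qed

section \<open>A state with many loops\<close>

text \<open>In each window of length \<open>N\<close> a path that ends the window in a high state has at most two choices.
  Only the last, incomplete window is unrestricted.\<close>

lemma card_high_paths:
  assumes N: "0 < N" and w: "adm m c d w"
  shows "card (Lex.paths m c d w (- low_states N) n) \<le> (m + 1) ^ N * 2 ^ (n div N)"
  using w
proof (induction n arbitrary: w rule: less_induct)
  case (less n)
  show ?case
  proof (cases "n \<le> N")
    case True
    have "Lex.paths m c d w (- low_states N) n \<subseteq> words m c d n"
      by (auto simp: Lex.paths_def words_def dest: adm_suffix)
    then have "card (Lex.paths m c d w (- low_states N) n) \<le> (m + 1) ^ n"
      using card_mono[OF finite_words] card_words_le order_trans by blast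
    also have "\<dots> \<le> (m + 1) ^ N" using True by (intro power_increasing) auto
    also have "\<dots> \<le> (m + 1) ^ N * 2 ^ (n div N)" by simp
    finally show ?thesis .
  next
    case False
    define X where "X = {z. length z = N \<and> adm m c d (w @ z) \<and> match_state c d (w @ z) \<notin> low_states N}"
    have finX: "finite X"
      by (rule finite_subset[OF _ Lex.finite_extensions[of N m c d w]]) (auto simp: X_def)
    have "Lex.paths m c d w (- low_states N) n
        \<subseteq> (\<Union>x\<in>X. (@) x ` Lex.paths m c d (w @ x) (- low_states N) (n - N))"
    proof
      fix z assume z: "z \<in> Lex.paths m c d w (- low_states N) n"
      then have len: "length z = n" and az: "adm m c d (w @ z)"
        and int: "\<And>k. 0 < k \<Longrightarrow> k < n \<Longrightarrow> match_state c d (w @ take k z) \<notin> low_states N"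
        by (auto simp: Lex.paths_def)
      have "adm m c d ((w @ take N z) @ drop N z)" using az by simp
      then have "adm m c d (w @ take N z)" by (rule Lex.adm_prefix)
      then have "take N z \<in> X" using int[of N] N False len by (auto simp: X_def)
      moreover have "match_state c d ((w @ take N z) @ take k (drop N z)) \<notin> low_states N" if "0 < k" "k < n - N" for k
      proof -
        have "(w @ take N z) @ take k (drop N z) = w @ take (N + k) z" by (simp add: take_add)
        then show ?thesis using int[of "N + k"] that by simp
      qed
      then have "drop N z \<in> Lex.paths m c d (w @ take N z) (- low_states N) (n - N)"
        using az len by (auto simp: Lex.paths_def)
      ultimately show "z \<in> (\<Union>x\<in>X. (@) x ` Lex.paths m c d (w @ x) (- low_states N) (n - N))"
        by (intro UN_I[of "take N z"] image_eqI[of _ _ "drop N z"]) simp_all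
    qed
    then have "card (Lex.paths m c d w (- low_states N) n)
        \<le> card (\<Union>x\<in>X. (@) x ` Lex.paths m c d (w @ x) (- low_states N) (n - N))"
      using finX by (intro card_mono finite_UN_I finite_imageI Lex.finite_paths)
    also have "\<dots> \<le> (\<Sum>x\<in>X. card ((@) x ` Lex.paths m c d (w @ x) (- low_states N) (n - N)))"
      using finX by (rule card_UN_le)
    also have "\<dots> \<le> (\<Sum>x\<in>X. (m + 1) ^ N * 2 ^ ((n - N) div N))"
    proof (rule sum_mono)
      fix x assume "x \<in> X"
      then have "card (Lex.paths m c d (w @ x) (- low_states N) (n - N)) \<le> (m + 1) ^ N * 2 ^ ((n - N) div N)"
        using False N by (intro less.IH) (auto simp: X_def)
      then show "card ((@) x ` Lex.paths m c d (w @ x) (- low_states N) (n - N)) \<le> (m + 1) ^ N * 2 ^ ((n - N) div N)"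
        using card_image_le[OF Lex.finite_paths] order_trans by blast
    qed
    also have "\<dots> = card X * ((m + 1) ^ N * 2 ^ ((n - N) div N))" by simp
    also have "\<dots> \<le> 2 * ((m + 1) ^ N * 2 ^ ((n - N) div N))"
      using card_high_extensions[of N m c d w] unfolding X_def by (intro mult_right_mono) auto
    also have "\<dots> = (m + 1) ^ N * 2 ^ (Suc ((n - N) div N))" by simp
    also have "Suc ((n - N) div N) = n div N" using False N by (simp add: le_div_geq)
    finally show ?thesis .
  qed
qed

lemma exists_many_loops:
  fixes r \<rho> :: real
  assumes r: "1 < r" "r < \<rho>" and growth: "\<And>n. \<rho> ^ n \<le> card (words m c d n)"
  shows "\<exists>N w n. 0 < n \<and> adm m c d w \<and> matches c w \<subseteq> {..<N} \<and> matches d w \<subseteq> {..<N} \<and>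
    r ^ n + real n \<le> card (Lex.loops m c d w n)"
proof -
  \<comment> \<open>Windows so long that two choices per window amount to growth at most \<open>r\<close>.\<close>
  obtain N0 where N0: "2 < r ^ N0" using real_arch_pow r by blast
  define N where "N = Suc N0"
  have N: "0 < N" "2 \<le> r ^ N"
    using N0 r less_imp_le[OF less_trans[OF N0 power_strict_increasing[of N0 "Suc N0" r]]] by (auto simp: N_def)
  have high: "card (Lex.paths m c d w (- low_states N) n) \<le> real ((m + 1) ^ N) * r ^ n" if "adm m c d w" for w n
  proof -
    have "real (2 ^ (n div N)) = 2 ^ (n div N)" by simp
    also have "\<dots> \<le> (r ^ N) ^ (n div N)" using N by (intro power_mono) auto
    also have "\<dots> = r ^ (N * (n div N))" by (simp add: power_mult)
    also have "\<dots> \<le> r ^ n" using r by (intro power_increasing) auto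
    finally have "real ((m + 1) ^ N) * real (2 ^ (n div N)) \<le> real ((m + 1) ^ N) * r ^ n"
      by (intro mult_left_mono) auto
    moreover have "real (card (Lex.paths m c d w (- low_states N) n)) \<le> real ((m + 1) ^ N * 2 ^ (n div N))"
      using card_high_paths[OF N(1) that] by (rule of_nat_mono)
    ultimately show ?thesis by (simp only: of_nat_mult)
  qed
  \<comment> \<open>The second summand pays for the \<open>n\<close> loops to be discarded later.\<close>
  define D where "D = 1 + 1 / (r - 1)"
  have D: "0 \<le> D" using r by (simp add: D_def)
  have "finite (low_states N)" by (simp add: low_states_def)
  moreover have "adm m c d []" by (simp add: adm_def obeys_def)
  moreover have "0 < r" "0 \<le> real ((m + 1) ^ N)" using r by auto
  ultimately have "\<exists>w n. adm m c d w \<and> match_state c d w \<in> low_states N \<and> D * r ^ n < card (Lex.loops m c d w n)"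
    using growth unfolding words_def by (intro Lex.many_loops[OF _ _ r(2) _ high _ _ D]) simp_all
  then obtain w n where w: "adm m c d w" "match_state c d w \<in> low_states N"
      and "D * r ^ n < card (Lex.loops m c d w n)" by blast
  moreover have "r ^ n + real n \<le> D * r ^ n"
    using power_ge_linear[OF r(1), of n] by (simp add: D_def algebra_simps)
  ultimately have card: "r ^ n + real n < card (Lex.loops m c d w n)" by simp
  have "n \<noteq> 0"
  proof
    assume "n = 0"
    then have "Lex.loops m c d w n \<subseteq> {[]}" by (auto simp: Lex.loops_def)
    then have "card (Lex.loops m c d w n) \<le> card {[] :: nat list}" by (intro card_mono) auto
    then show False using card \<open>n = 0\<close> by simp
  qed
  then show ?thesis using card w by (intro exI[of _ N] exI[of _ w] exI[of _ n]) (auto simp: match_state_def low_states_def)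
qed

section \<open>Concatenations of loops\<close>

text \<open>The infinite concatenation of the blocks \<open>f 0, f 1, \<dots>\<close>, for blocks of common length \<open>n\<close>.\<close>

definition cat :: "nat \<Rightarrow> (nat \<Rightarrow> nat list) \<Rightarrow> nat \<Rightarrow> nat" where
  "cat n f i = f (i div n) ! (i mod n)"

lemma prefix_cat:
  assumes n: "0 < n" and f: "\<And>i. length (f i) = n"
  shows "map (cat n f) [0..<k * n] = concat (map f [0..<k])"
proof (induction k)
  case (Suc k)
  have "map (cat n f) [k * n..<k * n + n] = f k"
  proof (rule nth_equalityI)
    fix i assume "i < length (map (cat n f) [k * n..<k * n + n])"
    then have "i < n" by simp
    then show "map (cat n f) [k * n..<k * n + n] ! i = f k ! i" using n by (simp add: cat_def)
  qed (simp add: f)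
  moreover have "[0..<Suc k * n] = [0..<k * n] @ [k * n..<k * n + n]"
    using upt_add_eq_append[of 0 "k * n" n] by (simp add: add.commute)
  ultimately show ?case using Suc by simp
qed simp

lemma loops_concat:
  assumes "adm m c d w" "set ss \<subseteq> Lex.loops m c d w n"
  shows "adm m c d (w @ concat ss) \<and> match_state c d (w @ concat ss) = match_state c d w"
  using assms(2)
proof (induction ss rule: rev_induct)
  case (snoc s ss)
  then have IH: "adm m c d (w @ concat ss)" "match_state c d (w @ concat ss) = match_state c d w"
    and s: "adm m c d (w @ s)" "match_state c d (w @ s) = match_state c d w"
    by (auto simp: Lex.loops_def)
  have "adm m c d ((w @ concat ss) @ s)"
    using Lex.adm_cong[OF assms(1) IH(1) IH(2)[symmetric] s(1)] .
  moreover have "match_state c d ((w @ concat ss) @ s) = match_state c d w"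
    using Lex.st_cong[OF IH(2), of s] s(2) by simp
  ultimately show ?case by simp
qed (use assms in simp)

text \<open>A coincidence of \<open>y\<close> with \<open>c\<close> along \<open>N + n\<close> entries would reach an end of a block after more than
  \<open>N\<close> entries, contrary to the bound on the matches there.\<close>

lemma strict_first_difference:
  fixes y :: "nat \<Rightarrow> nat"
  assumes n: "0 < n" and ob: "\<And>k. obeys R c (map y [0..<k * n])"
    and short: "\<And>k. matches c (map y [0..<k * n]) \<subseteq> {..<N}"
  shows "\<exists>j<N + n. (\<forall>i<j. y (q + i) = c i) \<and> y (q + j) \<noteq> c j \<and> \<not> R (y (q + j)) (c j)"
proof -
  have "\<exists>j<N + n. y (q + j) \<noteq> c j"
  proof (rule ccontr)
    assume "\<not> ?thesis"
    then have eq: "y (q + i) = c i" if "i < N + n" for i using that by blast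
    \<comment> \<open>The first end of a block that lies beyond position \<open>q + N\<close>.\<close>
    define k where "k = (q + N) div n + 1"
    define a where "a = k * n - q"
    have div: "(q + N) div n * n \<le> q + N" "q + N < (q + N) div n * n + n"
      using n dividend_less_div_times[of n "q + N"] by auto
    have kn: "q + N < k * n" "k * n \<le> q + N + n" using div by (auto simp: k_def)
    have "a \<in> matches c (map y [0..<k * n])"
      unfolding matches_def using kn eq by (auto simp: a_def)
    then have "a < N" using short by auto
    then show False using kn by (simp add: a_def)
  qed
  then obtain j where j: "j < N + n" "y (q + j) \<noteq> c j" "\<And>i. i < j \<Longrightarrow> \<not> (i < N + n \<and> y (q + i) \<noteq> c i)"
    using exists_least_iff[of "\<lambda>j. j < N + n \<and> y (q + j) \<noteq> c j"] by blast
  then have eq: "\<forall>i<j. y (q + i) = c i" by (meson order_less_trans)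
  have len: "q + j < (q + j + 1) * n" using n by (cases n) auto
  have "\<not> R (map y [0..<(q + j + 1) * n] ! (q + j)) (c j)"
    using ob[of "q + j + 1", unfolded obeys_def, rule_format, of q j] len eq by simp
  then show ?thesis using j eq len by auto
qed

text \<open>A shifted concatenation of loops parts from \<open>c\<close> and from \<open>d\<close> within their first \<open>N + n\<close> entries, so
  that the later entries of the bounds are irrelevant.\<close>

lemma loop_sequence_between:
  fixes f :: "nat \<Rightarrow> nat list"
  assumes w: "adm m c d w" "matches c w \<subseteq> {..<N}" "matches d w \<subseteq> {..<N}"
    and f: "\<And>i. f i \<in> Lex.loops m c d w n" and n: "0 < n"
    and agree: "\<And>i. i < N + n \<Longrightarrow> c' i = c i" "\<And>i. i < N + n \<Longrightarrow> d' i = d i"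
  shows "c' \<prec> (\<lambda>i. cat n f (q + i))" "(\<lambda>i. cat n f (q + i)) \<prec> d'" "cat n f q \<le> m"
proof -
  have len: "length (f i) = n" for i using f[of i] by (simp add: Lex.loops_def)
  have pre: "adm m c d (w @ map (cat n f) [0..<k * n])"
      "match_state c d (w @ map (cat n f) [0..<k * n]) = match_state c d w" for k
    using loops_concat[OF w(1), of "map f [0..<k]" n] f unfolding prefix_cat[OF n len] by auto
  have sub: "adm m c d (map (cat n f) [0..<k * n])" for k
    using pre(1) by (rule adm_suffix)
  have mat: "matches c (map (cat n f) [0..<k * n]) \<subseteq> {..<N}" "matches d (map (cat n f) [0..<k * n]) \<subseteq> {..<N}" for k
    using pre(2)[of k] w(2,3) by (auto simp: match_state_def matches_append)
  obtain j where "j < N + n" "\<forall>i<j. cat n f (q + i) = c i" "cat n f (q + j) \<noteq> c j" "\<not> cat n f (q + j) < c j"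
    using strict_first_difference[OF n, of "(<)" c "cat n f" N q] sub mat unfolding adm_def by blast
  then show "c' \<prec> (\<lambda>i. cat n f (q + i))"
    unfolding less_fun_def by (intro exI[of _ j]) (auto simp: agree)
  obtain j where "j < N + n" "\<forall>i<j. cat n f (q + i) = d i" "cat n f (q + j) \<noteq> d j" "\<not> cat n f (q + j) > d j"
    using strict_first_difference[OF n, of "(>)" d "cat n f" N q] sub mat unfolding adm_def by blast
  then show "(\<lambda>i. cat n f (q + i)) \<prec> d'"
    unfolding less_fun_def by (intro exI[of _ j]) (auto simp: agree)
  have "q < Suc q * n" using n by (cases n) auto
  then have "cat n f q \<in> set (map (cat n f) [0..<Suc q * n])" by force
  then show "cat n f q \<le> m" using sub[of "Suc q"] unfolding adm_def by blast
qed

section \<open>The lexicographic order on concatenations\<close>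

lemma lex_le_iff:
  fixes x y :: "nat \<Rightarrow> nat"
  shows "x \<preceq> y \<longleftrightarrow> (\<forall>i. (\<forall>j<i. x j = y j) \<longrightarrow> x i \<le> y i)" (is "?L \<longleftrightarrow> ?R")
proof
  assume ?L
  then show ?R
  proof
    assume "x \<prec> y"
    then obtain k where k: "x k < y k" "\<And>k'. k' < k \<Longrightarrow> x k' = y k'" unfolding less_fun_def by blast
    show ?R
    proof (intro allI impI)
      fix i assume "\<forall>j<i. x j = y j"
      then have "i \<le> k" using k(1) by (metis leI less_irrefl)
      then show "x i \<le> y i" using k by (cases "i = k") auto
    qed
  qed simp
next
  assume r: ?R
  show ?L
  proof (cases "x = y")
    case False
    then have "\<exists>i. x i \<noteq> y i" by blast
    then obtain i where i: "x i \<noteq> y i" "\<And>j. j < i \<Longrightarrow> x j = y j"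
      using exists_least_iff[of "\<lambda>i. x i \<noteq> y i"] by blast
    then have "x i < y i" using r by (simp add: order_less_le)
    then show ?thesis using i by (auto simp: less_fun_def)
  qed simp
qed

lemma lex_total: "x \<prec> y \<or> y \<preceq> x" for x y :: "nat \<Rightarrow> nat"
proof (rule disjCI)
  assume "\<not> y \<preceq> x"
  then obtain i where i: "\<forall>j<i. y j = x j" "\<not> y i \<le> x i" unfolding lex_le_iff by blast
  then show "x \<prec> y" unfolding less_fun_def by (intro exI[of _ i]) auto
qed

lemma lex_le_trans:
  fixes x y z :: "nat \<Rightarrow> nat"
  shows "x \<preceq> y \<Longrightarrow> y \<preceq> z \<Longrightarrow> x \<preceq> z"
  using less_fun_trans by blast

lemma finite_lex_max:
  fixes X :: "(nat \<Rightarrow> nat) set"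
  assumes "finite X" "X \<noteq> {}"
  shows "\<exists>x\<in>X. \<forall>y\<in>X. y \<preceq> x"
  using assms
proof (induction X rule: finite_ne_induct)
  case (insert x F)
  then obtain z where z: "z \<in> F" "\<forall>y\<in>F. y \<preceq> z" by blast
  show ?case
  proof (cases "x \<preceq> z")
    case True
    then show ?thesis using z by blast
  next
    case False
    then have "z \<preceq> x" using lex_total[of z x] by blast
    then have "\<forall>y\<in>insert x F. y \<preceq> x" using z(2) lex_le_trans by blast
    then show ?thesis by blast
  qed
qed simp

lemma lex_le_tail:
  fixes x y :: "nat \<Rightarrow> nat"
  assumes "x \<preceq> y" "\<And>j. j < q \<Longrightarrow> x j = y j"
  shows "(\<lambda>i. x (q + i)) \<preceq> (\<lambda>i. y (q + i))"
  unfolding lex_le_iff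
proof (intro allI impI)
  fix i assume eq: "\<forall>j<i. x (q + j) = y (q + j)"
  have "x j = y j" if "j < q + i" for j
  proof (cases "j < q")
    case False
    then have "j - q < i" "q + (j - q) = j" using that by auto
    then show ?thesis using eq by metis
  qed (use assms in simp)
  then show "x (q + i) \<le> y (q + i)" using assms(1) unfolding lex_le_iff by blast
qed

text \<open>For blocks of equal length, the comparison of \<open>a\<close> and \<open>b\<close> is encoded as that of the periodic
  sequences \<open>a a a \<dots>\<close> and \<open>b b b \<dots>\<close>.\<close>

lemma cat_le_cat:
  assumes "0 < n" "\<And>k. cat n (\<lambda>_. f k) \<preceq> cat n (\<lambda>_. g k)"
  shows "cat n f \<preceq> cat n g"
  unfolding lex_le_iff
proof (intro allI impI)
  fix i assume eq: "\<forall>j<i. cat n f j = cat n g j"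
  define k where "k = i div n"
  define r where "r = i mod n"
  have i: "i = n * k + r" "r < n" using assms(1) by (auto simp: k_def r_def)
  have "cat n (\<lambda>_. f k) r' = cat n (\<lambda>_. g k) r'" if "r' < r" for r'
  proof -
    have "cat n f (n * k + r') = cat n g (n * k + r')" using eq that i by simp
    then show ?thesis using that i(2) by (simp add: cat_def)
  qed
  then have "cat n (\<lambda>_. f k) r \<le> cat n (\<lambda>_. g k) r" using assms(2)[of k] unfolding lex_le_iff by blast
  then show "cat n f i \<le> cat n g i" using i by (simp add: cat_def)
qed

lemma cat_block: "i < n \<Longrightarrow> cat n f (k * n + i) = f k ! i"
  by (simp add: cat_def)

lemma shift_cat:
  assumes "0 < n"
  shows "(\<lambda>i. cat n f (q + i)) = (\<lambda>i. cat n (\<lambda>k. f (q div n + k)) (q mod n + i))"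
proof
  fix i
  have "q + i = (q mod n + i) + (q div n) * n" by (simp add: add.assoc[symmetric] add.commute)
  then have "(q + i) div n = q div n + (q mod n + i) div n" "(q + i) mod n = (q mod n + i) mod n"
    using assms by (metis add.commute div_mult_self1 less_numeral_extra(3), metis mod_mult_self1)
  then show "cat n f (q + i) = cat n (\<lambda>k. f (q div n + k)) (q mod n + i)"
    by (simp add: cat_def)
qed

text \<open>Replacing every block except the first by the largest block \<open>b\<close> can only increase a shifted
  concatenation. So the maximum is attained among the finitely many sequences that are determined by
  the first block and by the offset \<open>p\<close> within it.\<close>

lemma exists_maximal_shift:
  assumes n: "0 < n" and S: "finite S" "S \<noteq> {}"
  shows "\<exists>a\<in>S. \<exists>b\<in>S. \<exists>p<n. \<forall>f q. (\<forall>k. f k \<in> S) \<longrightarrow>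
    (\<lambda>i. cat n f (q + i)) \<preceq> (\<lambda>i. cat n (\<lambda>k. if k = 0 then a else b) (p + i))"
proof -
  have "\<exists>x\<in>(\<lambda>b. cat n (\<lambda>_. b)) ` S. \<forall>y\<in>(\<lambda>b. cat n (\<lambda>_. b)) ` S. y \<preceq> x"
    using S by (intro finite_lex_max) auto
  then obtain b where b: "b \<in> S" "\<And>a. a \<in> S \<Longrightarrow> cat n (\<lambda>_. a) \<preceq> cat n (\<lambda>_. b)" by blast
  define t where "t = (\<lambda>(a, p) i. cat n (\<lambda>k. if k = 0 then a else b) (p + i))"
  have "\<exists>x\<in>t ` (S \<times> {..<n}). \<forall>y\<in>t ` (S \<times> {..<n}). y \<preceq> x"
    using S n by (intro finite_lex_max) auto
  then obtain a p where ap: "a \<in> S" "p < n" "\<And>a' q. a' \<in> S \<Longrightarrow> q < n \<Longrightarrow> t (a', q) \<preceq> t (a, p)" by blast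
  have "(\<lambda>i. cat n f (q + i)) \<preceq> t (a, p)" if f: "\<And>k. f k \<in> S" for f q
  proof -
    define g where "g = (\<lambda>k. f (q div n + k))"
    define h where "h = (\<lambda>k::nat. if k = 0 then g 0 else b)"
    have "cat n g \<preceq> cat n h"
      by (rule cat_le_cat[OF n]) (use b f in \<open>auto simp: g_def h_def\<close>)
    moreover have "cat n g j = cat n h j" if "j < q mod n" for j
    proof -
      have "j < n" using that n mod_less_divisor[OF n, of q] by linarith
      then show ?thesis by (simp add: cat_def h_def)
    qed
    ultimately have "(\<lambda>i. cat n g (q mod n + i)) \<preceq> (\<lambda>i. cat n h (q mod n + i))"
      by (intro lex_le_tail) auto
    also have "(\<lambda>i. cat n h (q mod n + i)) = t (g 0, q mod n)" by (simp add: t_def h_def)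
    finally have "(\<lambda>i. cat n g (q mod n + i)) \<preceq> t (a, p)"
      using lex_le_trans ap(3)[of "g 0" "q mod n"] f n unfolding g_def by fastforce
    then show ?thesis using shift_cat[OF n, of f q] by (simp add: g_def)
  qed
  then have "\<forall>f q. (\<forall>k. f k \<in> S) \<longrightarrow>
      (\<lambda>i. cat n f (q + i)) \<preceq> (\<lambda>i. cat n (\<lambda>k. if k = 0 then a else b) (p + i))"
    unfolding t_def prod.case by blast
  then show ?thesis using ap(1,2) b(1) by blast
qed

text \<open>A stretch \<open>b b\<close> of length \<open>2n\<close> contains a complete block, whatever its offset to the blocks.\<close>

lemma cat_rotation:
  assumes n: "0 < n" and b: "length b = n" and len: "\<And>k. length (F k) = n"
    and eq: "\<And>t. n \<le> t \<Longrightarrow> t < 3 * n \<Longrightarrow> cat n F (q + t) = b ! (t mod n)"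
  shows "F (q div n + 2) \<in> (\<lambda>e. rotate e b) ` {..<n}"
proof -
  \<comment> \<open>The distance from \<open>q\<close> to the first block that starts after position \<open>q + n\<close>.\<close>
  define e where "e = (q div n + 2) * n - q"
  have qq: "q div n * n \<le> q" "q < q div n * n + n"
    using n dividend_less_div_times[of n q] by auto
  have e: "n < e" "e \<le> 2 * n" "(q div n + 2) * n = q + e"
    using qq add_mult_distrib[of "q div n" 2 n] unfolding e_def by linarith+
  have "F (q div n + 2) = rotate e b"
  proof (rule nth_equalityI)
    fix i assume "i < length (F (q div n + 2))"
    then have i: "i < n" using len by simp
    have "F (q div n + 2) ! i = cat n F ((q div n + 2) * n + i)" by (rule cat_block[OF i, symmetric])
    also have "(q div n + 2) * n + i = q + (e + i)" using e(3) by simp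
    also have "cat n F (q + (e + i)) = b ! ((e + i) mod n)" using e i by (intro eq) auto
    also have "\<dots> = rotate e b ! i" using i b by (simp add: nth_rotate)
    finally show "F (q div n + 2) ! i = rotate e b ! i" .
  qed (simp add: len b)
  also have "\<dots> = rotate (e mod n) b" using b rotate_conv_mod by metis
  finally show ?thesis using n by (intro image_eqI[of _ _ "e mod n"]) auto
qed

text \<open>Let \<open>x\<close> be the sequence on the right, \<open>s\<close> the maximal one, and \<open>M\<close> the first position where they
  differ; it lies in the fourth block, because that block is not \<open>b\<close>, and \<open>x M < s M\<close>. A shift by
  \<open>q \<le> M\<close> is smaller than \<open>x\<close>: up to the drop at \<open>M\<close> it is the shift of \<open>s\<close>, which is at most \<open>s\<close>. A
  shift by \<open>q > M\<close> is at most \<open>s\<close>, and it leaves \<open>s\<close> before position \<open>M\<close>: otherwise it would contain \<open>b b\<close>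
  inside the blocks from the fourth on, none of which is a rotation of \<open>b\<close>.\<close>

lemma dominates_its_shifts:
  fixes F :: "nat \<Rightarrow> nat list"
  assumes n: "0 < n" and p: "p < n" and S: "\<And>a. a \<in> S \<Longrightarrow> length a = n" and b: "b \<in> S"
    and max: "\<And>f q. (\<And>k. f k \<in> S) \<Longrightarrow>
      (\<lambda>i. cat n f (q + i)) \<preceq> (\<lambda>i. cat n (\<lambda>k. if k = 0 then a else b) (p + i))"
    and F: "F 0 = a" "F 1 = b" "F 2 = b" "a \<in> S"
      "\<And>k. 3 \<le> k \<Longrightarrow> F k \<in> S - (\<lambda>e. rotate e b) ` {..<n}"
    and q: "0 < q"
  shows "(\<lambda>i. cat n F (p + (q + i))) \<prec> (\<lambda>i. cat n F (p + i))"
proof (rule ccontr)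
  define x where "x = (\<lambda>i. cat n F (p + i))"
  define s where "s = (\<lambda>i. cat n (\<lambda>k. if k = 0 then a else b) (p + i))"
  define y where "y = (\<lambda>i. cat n F (p + (q + i)))"
  assume "\<not> ?thesis"
  then have xy: "x \<preceq> y" using lex_total[of y x] unfolding x_def y_def by blast
  have yx: "y i = x (q + i)" for i by (simp add: x_def y_def)
  have FS: "F k \<in> S" for k
  proof -
    consider "k = 0" | "k = 1" | "k = 2" | "3 \<le> k" by linarith
    then show ?thesis using F b by cases auto
  qed
  have len: "length (F k) = n" for k using S FS by blast
  have xs: "x \<preceq> s" and ys: "y \<preceq> s"
    using max[of F p] max[of F "p + q"] FS unfolding x_def s_def y_def by (auto simp: add.assoc)
  have ss: "(\<lambda>i. s (q + i)) \<preceq> s"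
    using max[of "\<lambda>k. if k = 0 then a else b" "p + q"] F(4) b unfolding s_def by (auto simp: add.assoc)
  have xs_eq: "x i = s i" if "p + i < 3 * n" for i
  proof -
    have "(p + i) div n < 3" using that n by (simp add: less_mult_imp_div_less)
    then consider "(p + i) div n = 0" | "(p + i) div n = 1" | "(p + i) div n = 2" by linarith
    then show ?thesis unfolding x_def s_def cat_def using F by cases auto
  qed
  have b0: "b \<in> (\<lambda>e. rotate e b) ` {..<n}" using n by (intro image_eqI[of _ _ 0]) auto
  have "F 3 \<noteq> b" using F(5)[of 3] b0 by auto
  then obtain r where r: "r < n" "F 3 ! r \<noteq> b ! r"
    using nth_equalityI[of "F 3" b] len S[OF b] by auto
  have "x (3 * n + r - p) \<noteq> s (3 * n + r - p)"
  proof -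
    have "p + (3 * n + r - p) = 3 * n + r" using p by simp
    then show ?thesis using r by (simp add: x_def s_def cat_def)
  qed
  then obtain M where M: "x M \<noteq> s M" "\<And>j. j < M \<Longrightarrow> x j = s j"
    using exists_least_iff[of "\<lambda>i. x i \<noteq> s i"] by blast
  have Mlt: "x M < s M" using xs M unfolding lex_le_iff by (simp add: order_less_le)
  have Mn: "3 * n \<le> p + M" using xs_eq[of M] M(1) by linarith
  show False
  proof (cases "q \<le> M")
    case True
    have eq: "y i = x i \<and> s (q + i) = s i" if "i < M - q" for i
      using that
    proof (induction i rule: less_induct)
      case (less i)
      have 1: "y i = s (q + i)" "x i = s i" using M(2)[of "q + i"] M(2)[of i] less.prems yx by auto
      have "x i \<le> y i" using xy less unfolding lex_le_iff by auto
      moreover have "s (q + i) \<le> s i" using ss less unfolding lex_le_iff by auto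
      ultimately show ?case using 1 by simp
    qed
    have "x (M - q) \<le> y (M - q)" using xy eq unfolding lex_le_iff by auto
    moreover have "s (q + (M - q)) \<le> s (M - q)" using ss eq unfolding lex_le_iff by auto
    moreover have "x (M - q) = s (M - q)" using M(2) True q by simp
    ultimately show False using True Mlt yx[of "M - q"] by simp
  next
    case False
    have eq: "y i = s i" if "i < M" for i
      using that
    proof (induction i rule: less_induct)
      case (less i)
      then have "\<forall>j<i. y j = s j" "\<forall>j<i. x j = y j" using M(2) by auto
      then have "x i \<le> y i" "y i \<le> s i" using xy ys unfolding lex_le_iff by blast+
      then show ?case using M(2)[of i] less.prems by simp
    qed
    have "cat n F (q + t) = b ! (t mod n)" if t: "n \<le> t" "t < 3 * n" for t
    proof -
      have "cat n F (q + t) = y (t - p)" using t p by (simp add: y_def add.left_commute)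
      also have "\<dots> = s (t - p)" using t Mn p by (intro eq) linarith
      also have "\<dots> = b ! (t mod n)"
        using t p div_greater_zero_iff[of t n] n by (simp add: s_def cat_def)
      finally show ?thesis .
    qed
    then have rot: "F (q div n + 2) \<in> (\<lambda>e. rotate e b) ` {..<n}"
      using cat_rotation[OF n S[OF b], of F q] len by blast
    have "n \<le> q" using False Mn p by linarith
    then have "3 \<le> q div n + 2" using n by (simp add: div_greater_zero_iff Suc_leI)
    then show False using rot F(5) by blast
  qed
qed

section \<open>Hausdorff dimension of sets of sequences\<close>

lemma hausdorff_dim_le_of_prefix_count:
  fixes s :: real
  assumes m: "1 \<le> m" and A: "A \<subseteq> seqs m" and s: "0 \<le> s"
    and count: "\<And>\<delta> \<epsilon>. 0 < \<delta> \<Longrightarrow> 0 < \<epsilon> \<Longrightarrow> \<exists>L. 1 / real (m + 1) ^ L \<le> \<delta> \<and>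
      real (card ((\<lambda>x. map x [0..<L]) ` A)) * (1 / real (m + 1) ^ L) powr s \<le> \<epsilon>"
  shows "hausdorff_dim (seq_metric m) A \<le> ennreal s"
proof -
  have pre: "hausdorff_premeasure (seq_metric m) s \<delta> A \<le> ennreal \<epsilon>" if "0 < \<delta>" "0 < \<epsilon>" for \<delta> \<epsilon>
  proof -
    from count[OF that] obtain L where L: "1 / real (m + 1) ^ L \<le> \<delta>"
      "real (card ((\<lambda>x. map x [0..<L]) ` A)) * (1 / real (m + 1) ^ L) powr s \<le> \<epsilon>"
      by blast
    define P where "P = (\<lambda>x. map x [0..<L]) ` A"
    define \<eta> where "\<eta> = 1 / real (m + 1) ^ L"
    have \<eta>: "0 < \<eta>" by (simp add: \<eta>_def)
    have finP: "finite P"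
    proof (rule finite_subset)
      show "P \<subseteq> {xs. set xs \<subseteq> {..m} \<and> length xs = L}" using A unfolding P_def seqs_def by fastforce
    qed (rule finite_lists_length_eq, simp)
    obtain h where h: "bij_betw h {0..<card P} P" using ex_bij_betw_nat_finite[OF finP] by blast
    define U where "U i = (if i < card P then {x \<in> A. map x [0..<L] = h i} else {})" for i
    have diam: "mdiam (seq_metric m) (U i) \<le> ennreal \<eta>" for i
      unfolding mdiam_def
    proof (rule SUP_least, clarify)
      fix x y assume xy: "x \<in> U i" "y \<in> U i"
      then have xyA: "x \<in> A" "y \<in> A" and "map x [0..<L] = h i" "map y [0..<L] = h i"
        by (auto simp: U_def split: if_splits)
      then have "map x [0..<L] = map y [0..<L]" by simp
      then have "\<forall>j\<in>set [0..<L]. x j = y j" by (simp only: map_eq_conv)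
      then have "seq_dist m x y \<le> \<eta>"
        unfolding \<eta>_def using A xyA by (intro seq_dist_upper[OF m]) auto
      then show "ennreal (mdist (seq_metric m) x y) \<le> ennreal \<eta>"
        using m by (simp add: ennreal_leI)
    qed
    have U: "U \<in> mesh_covers (seq_metric m) \<delta> A"
      unfolding mesh_covers_def
    proof (intro CollectI conjI allI)
      show "U i \<subseteq> mspace (seq_metric m)" for i using A m by (auto simp: U_def)
      show "mdiam (seq_metric m) (U i) \<le> ennreal \<delta>" for i
        using diam[of i] L(1) order_trans ennreal_leI unfolding \<eta>_def by blast
      show "A \<subseteq> (\<Union>i. U i)"
      proof
        fix x assume x: "x \<in> A"
        then have "map x [0..<L] \<in> h ` {0..<card P}" using h unfolding bij_betw_def P_def by blast
        then show "x \<in> (\<Union>i. U i)" using x by (force simp: U_def)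
      qed
    qed
    have dp: "diam_powr (seq_metric m) s (U i) \<le> ennreal (\<eta> powr s)" for i
    proof -
      have "enn2real (mdiam (seq_metric m) (U i)) \<le> \<eta>"
        using enn2real_mono[OF diam[of i]] \<eta> by simp
      then have "enn2real (mdiam (seq_metric m) (U i)) powr s \<le> \<eta> powr s"
        using s by (intro powr_mono2) auto
      then show ?thesis using \<eta> by (auto simp: diam_powr_def intro: ennreal_leI)
    qed
    have "hausdorff_premeasure (seq_metric m) s \<delta> A \<le> (\<Sum>i. diam_powr (seq_metric m) s (U i))"
      unfolding hausdorff_premeasure_def using U by (rule INF_lower)
    also have "\<dots> = (\<Sum>i<card P. diam_powr (seq_metric m) s (U i))"
      by (rule suminf_finite) (auto simp: U_def diam_powr_def)
    also have "\<dots> \<le> (\<Sum>i<card P. ennreal (\<eta> powr s))" by (intro sum_mono dp)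
    also have "\<dots> = ennreal (real (card P) * \<eta> powr s)"
      by (simp add: ennreal_mult ennreal_of_nat_eq_real_of_nat)
    also have "\<dots> \<le> ennreal \<epsilon>" using L(2) by (intro ennreal_leI) (simp add: P_def \<eta>_def)
    finally show ?thesis .
  qed
  have "hausdorff_premeasure (seq_metric m) s \<delta> A \<le> 0" if "0 < \<delta>" for \<delta>
  proof (rule ennreal_le_epsilon)
    fix \<epsilon> :: real assume "0 < \<epsilon>"
    then show "hausdorff_premeasure (seq_metric m) s \<delta> A \<le> 0 + ennreal \<epsilon>"
      using pre[OF that] by simp
  qed
  then have "hausdorff_measure (seq_metric m) s A = 0" by (simp add: hausdorff_measure_def)
  then show ?thesis unfolding hausdorff_dim_def using s by (intro Inf_lower imageI) simp
qed

text \<open>The uniform Bernoulli measure gives a cylinder that fixes \<open>k\<close> blocks the mass \<open>(card T)\<^sup>-\<^sup>k\<close>.\<close>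

lemma cylinder_measure:
  fixes T :: "'a set" and g :: "nat \<Rightarrow> 'a"
  assumes T: "finite T" "T \<noteq> {}" and g: "\<And>i. g i \<in> T"
  shows "{f. (\<forall>i. f i \<in> T) \<and> (\<forall>i<k. f i = g i)} \<in> sets (PiM UNIV (\<lambda>_. uniform_count_measure T))" (is "?C \<in> _")
    and "emeasure (PiM UNIV (\<lambda>_. uniform_count_measure T)) {f. (\<forall>i. f i \<in> T) \<and> (\<forall>i<k. f i = g i)}
      = ennreal (1 / real (card T) ^ k)"
proof -
  interpret product_prob_space "\<lambda>_. uniform_count_measure T" "UNIV :: nat set"
    using prob_space_uniform_count_measure[OF T]
    by (simp add: product_prob_space_def product_prob_space_axioms_def product_sigma_finite_def prob_space_imp_sigma_finite)
  have C: "?C = prod_emb UNIV (\<lambda>_. uniform_count_measure T) {..<k} (\<Pi>\<^sub>E i\<in>{..<k}. {g i})"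
    by (auto simp: prod_emb_def space_uniform_count_measure PiE_iff restrict_def extensional_def)
  show "?C \<in> sets (PiM UNIV (\<lambda>_. uniform_count_measure T))"
    unfolding C by (rule sets_PiM_I) (use g in \<open>auto simp: sets_uniform_count_measure\<close>)
  have "emeasure (PiM UNIV (\<lambda>_. uniform_count_measure T)) ?C = (\<Prod>i<k. emeasure (uniform_count_measure T) {g i})"
    unfolding C using g by (intro emeasure_PiM_emb) (auto simp: sets_uniform_count_measure)
  also have "\<dots> = (\<Prod>i<k. ennreal (1 / real (card T)))"
    using g T by (intro prod.cong) (simp_all add: emeasure_uniform_count_measure)
  also have "\<dots> = ennreal (1 / real (card T) ^ k)" by (simp add: ennreal_power power_divide)
  finally show "emeasure (PiM UNIV (\<lambda>_. uniform_count_measure T)) ?C = ennreal (1 / real (card T) ^ k)" .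
qed

text \<open>Mass distribution principle for the image of the uniform Bernoulli measure under
  \<open>f \<mapsto> z\<^sub>0 \<dots> z\<^sub>e\<^sub>-\<^sub>1 f\<^sub>0 f\<^sub>1 \<dots>\<close>. A set of positive diameter is compared with the smallest cylinder that
  contains its preimage: two points of the set differ within the next block.\<close>

lemma hausdorff_dim_ge_of_free_blocks:
  fixes s :: real
  assumes m: "1 \<le> m" and n: "0 < n" and T: "finite T" "\<And>a. a \<in> T \<Longrightarrow> length a = n"
    and s: "0 < s" and card: "real (m + 1) powr (s * n) \<le> card T"
    and A: "A \<subseteq> seqs m" "\<And>f. (\<And>k. f k \<in> T) \<Longrightarrow> (\<lambda>i. if i < e then z i else cat n f (i - e)) \<in> A"
  shows "ennreal s \<le> hausdorff_dim (seq_metric m) A"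
  unfolding hausdorff_dim_def
proof (rule Inf_greatest, clarify, rule ennreal_leI, rule ccontr)
  fix t assume t: "0 \<le> t" and zero: "hausdorff_measure (seq_metric m) t A = 0" and "\<not> s \<le> t"
  then have ts: "t < s" by simp
  define B where "B = real (m + 1)"
  have B: "1 < B" using m by (simp add: B_def)
  define \<phi> where "\<phi> f = (\<lambda>i. if i < e then z i else cat n f (i - e))" for f
  define \<Omega> where "\<Omega> = {f :: nat \<Rightarrow> nat list. \<forall>k. f k \<in> T}"
  define \<mu> where "\<mu> = PiM UNIV (\<lambda>_::nat. uniform_count_measure T)"
  \<comment> \<open>Two points whose first \<open>k\<close> free blocks agree, but not the next, have distance at least
    \<open>B powr - (e + (k + 1) * n)\<close>; the factor makes up for \<open>e\<close> and for the last block.\<close>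
  define K where "K = B powr (t * (e + n))"
  have K: "0 < K" using B by (simp add: K_def)
  have cardT: "1 < real (card T)"
  proof -
    have "1 < real (m + 1) powr (s * n)" using m n s by (intro gr_one_powr) auto
    then show ?thesis using card by linarith
  qed
  then have Tne: "T \<noteq> {}" by auto
  have space: "space \<mu> = \<Omega>" by (auto simp: \<mu>_def \<Omega>_def space_PiM space_uniform_count_measure)
  define cyl where "cyl g k = {f. (\<forall>i. f i \<in> T) \<and> (\<forall>i<k. f i = g i)}" for g :: "nat \<Rightarrow> nat list" and k :: nat
  have cyl: "cyl g k \<in> sets \<mu>" "emeasure \<mu> (cyl g k) = ennreal (1 / real (card T) ^ k)" if "g \<in> \<Omega>" for g k
    using cylinder_measure[OF T(1) Tne, of g k] that unfolding \<mu>_def cyl_def \<Omega>_def by auto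
  have total: "emeasure \<mu> (space \<mu>) = 1"
    unfolding \<mu>_def
    by (intro prob_space.emeasure_space_1 prob_space_PiM prob_space_uniform_count_measure T(1) Tne)
  have piece: "\<exists>C\<in>sets \<mu>. {f \<in> \<Omega>. \<phi> f \<in> U} \<subseteq> C \<and> emeasure \<mu> C \<le> ennreal K * diam_powr (seq_metric m) t U"
    if fin: "mdiam (seq_metric m) U \<le> ennreal 1" and "U \<subseteq> seqs m" for U
  proof -
    define P where "P = {f \<in> \<Omega>. \<phi> f \<in> U}"
    consider "P = {}" | g where "g \<in> P" "\<And>k. P \<subseteq> cyl g k" | g k where "g \<in> P" "\<not> P \<subseteq> cyl g k" by blast
    then show ?thesis
    proof cases
      case 1
      then show ?thesis by (intro bexI[of _ "{}"]) (auto simp: P_def)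
    next
      case 2
      then have g: "g \<in> \<Omega>" by (simp add: P_def)
      \<comment> \<open>Here \<open>U\<close> may have diameter 0, so that only a null set is good enough.\<close>
      define C where "C = (\<Inter>k. cyl g k)"
      have C: "C \<in> sets \<mu>" unfolding C_def using cyl(1)[OF g] by auto
      have "emeasure \<mu> C \<le> ennreal ((1 / real (card T)) ^ k)" for k
      proof -
        have "emeasure \<mu> C \<le> emeasure \<mu> (cyl g k)"
          unfolding C_def using cyl(1)[OF g] by (intro emeasure_mono) auto
        then show ?thesis using cyl(2)[OF g] by (simp add: power_divide)
      qed
      moreover have "(\<lambda>k. ennreal ((1 / real (card T)) ^ k)) \<longlonglongrightarrow> ennreal 0"
        using cardT by (intro tendsto_ennrealI LIMSEQ_realpow_zero) auto
      ultimately have "emeasure \<mu> C \<le> ennreal 0"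
        by (intro LIMSEQ_le_const) auto
      then show ?thesis using C 2 by (intro bexI[of _ C]) (auto simp: P_def C_def)
    next
      case 3
      then have g: "g \<in> \<Omega>" by (simp add: P_def)
      have "P \<subseteq> cyl g 0" by (auto simp: P_def cyl_def \<Omega>_def)
      with 3(2) obtain k where k: "P \<subseteq> cyl g k" "\<not> P \<subseteq> cyl g (Suc k)"
        using ex_least_nat_less[of "\<lambda>k. \<not> P \<subseteq> cyl g k"] by (metis dual_order.refl neq0_conv)
      then obtain f where f: "f \<in> P" "f \<notin> cyl g (Suc k)" by blast
      have fk: "f k \<noteq> g k" using f k(1) by (auto simp: cyl_def P_def \<Omega>_def less_Suc_eq)
      have "length (f k) = n" "length (g k) = n" using f(1) g T(2) by (auto simp: P_def \<Omega>_def)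
      then obtain r where r: "r < n" "f k ! r \<noteq> g k ! r" using fk nth_equalityI[of "f k" "g k"] by auto
      have "\<phi> f (e + (k * n + r)) \<noteq> \<phi> g (e + (k * n + r))"
        using r by (simp add: \<phi>_def cat_def)
      moreover have U: "\<phi> f \<in> U" "\<phi> g \<in> U" using f(1) 3(1) by (auto simp: P_def)
      ultimately have "1 / real (m + 1) ^ Suc (e + (k * n + r)) \<le> seq_dist m (\<phi> f) (\<phi> g)"
        using \<open>U \<subseteq> seqs m\<close> by (intro seq_dist_lower[OF m]) auto
      moreover have "1 / B ^ (e + (k + 1) * n) \<le> 1 / real (m + 1) ^ Suc (e + (k * n + r))"
        unfolding B_def using r m by (intro divide_left_mono power_increasing) auto
      ultimately have "1 / B ^ (e + (k + 1) * n) \<le> seq_dist m (\<phi> f) (\<phi> g)" by linarith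
      then have "ennreal (1 / B ^ (e + (k + 1) * n)) \<le> ennreal (mdist (seq_metric m) (\<phi> f) (\<phi> g))"
        using m by (simp add: ennreal_leI)
      also have "\<dots> \<le> mdiam (seq_metric m) U"
        unfolding mdiam_def using U by (intro SUP_upper2[of "(\<phi> f, \<phi> g)"]) auto
      finally have "enn2real (ennreal (1 / B ^ (e + (k + 1) * n))) \<le> enn2real (mdiam (seq_metric m) U)"
        using fin by (intro enn2real_mono) (auto simp: less_top[symmetric] top_unique)
      then have D: "1 / B ^ (e + (k + 1) * n) \<le> enn2real (mdiam (seq_metric m) U)"
        using B by simp
      have Bp: "1 / B ^ j = B powr (- real j)" for j
        using B by (simp add: powr_minus powr_realpow divide_inverse)
      have "(1 / B ^ (e + (k + 1) * n)) powr t \<le> enn2real (mdiam (seq_metric m) U) powr t"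
        using D t B by (intro powr_mono2) auto
      then have dp: "ennreal ((1 / B ^ (e + (k + 1) * n)) powr t) \<le> diam_powr (seq_metric m) t U"
        using U B by (auto simp: diam_powr_def intro: ennreal_leI)
      have "1 / real (card T) ^ k \<le> 1 / (B powr (s * n)) ^ k"
        using card B cardT unfolding B_def[symmetric] by (intro divide_left_mono power_mono mult_pos_pos) auto
      also have "\<dots> = B powr (- (s * n * k))"
        using B by (simp add: powr_minus powr_powr powr_realpow[symmetric] divide_inverse mult.assoc)
      also have "\<dots> \<le> B powr (- (t * n * k))"
        using B ts by (intro powr_mono) (auto intro!: mult_right_mono)
      also have "\<dots> = K * (1 / B ^ (e + (k + 1) * n)) powr t"
        unfolding Bp K_def powr_powr using B by (simp add: powr_add[symmetric] algebra_simps)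
      finally have "emeasure \<mu> (cyl g k) \<le> ennreal (K * (1 / B ^ (e + (k + 1) * n)) powr t)"
        unfolding cyl(2)[OF g] by (rule ennreal_leI)
      also have "\<dots> = ennreal K * ennreal ((1 / B ^ (e + (k + 1) * n)) powr t)"
        using K by (intro ennreal_mult) auto
      also have "\<dots> \<le> ennreal K * diam_powr (seq_metric m) t U"
        using dp by (intro mult_left_mono) auto
      finally show ?thesis using k(1) cyl(1)[OF g] by (auto simp: P_def)
    qed
  qed
  have lower: "1 \<le> ennreal K * (\<Sum>i. diam_powr (seq_metric m) t (U i))"
    if U: "U \<in> mesh_covers (seq_metric m) 1 A" for U
  proof -
    have "\<forall>i. \<exists>C. C \<in> sets \<mu> \<and> {f \<in> \<Omega>. \<phi> f \<in> U i} \<subseteq> C \<and>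
        emeasure \<mu> C \<le> ennreal K * diam_powr (seq_metric m) t (U i)"
      using U m piece unfolding mesh_covers_def Bex_def by simp
    from choice[OF this] obtain C where C: "\<And>i. C i \<in> sets \<mu>" "\<And>i. {f \<in> \<Omega>. \<phi> f \<in> U i} \<subseteq> C i"
        "\<And>i. emeasure \<mu> (C i) \<le> ennreal K * diam_powr (seq_metric m) t (U i)" by auto
    have "space \<mu> \<subseteq> (\<Union>i. C i)"
    proof
      fix f assume "f \<in> space \<mu>"
      then have f: "f \<in> \<Omega>" by (simp add: space)
      then have "\<phi> f \<in> A" unfolding \<phi>_def \<Omega>_def by (intro A(2)) auto
      then obtain i where "\<phi> f \<in> U i" using U by (auto simp: mesh_covers_def)
      then show "f \<in> (\<Union>i. C i)" using C(2)[of i] f by blast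
    qed
    then have "1 \<le> emeasure \<mu> (\<Union>i. C i)"
      unfolding total[symmetric] using C(1) by (intro emeasure_mono) auto
    also have "\<dots> \<le> (\<Sum>i. emeasure \<mu> (C i))"
      using C(1) by (intro emeasure_subadditive_countably) auto
    also have "\<dots> \<le> (\<Sum>i. ennreal K * diam_powr (seq_metric m) t (U i))"
      by (intro suminf_le C(3)) auto
    also have "\<dots> = ennreal K * (\<Sum>i. diam_powr (seq_metric m) t (U i))" by simp
    finally show ?thesis .
  qed
  have "hausdorff_premeasure (seq_metric m) t 1 A \<le> hausdorff_measure (seq_metric m) t A"
    unfolding hausdorff_measure_def by (intro SUP_upper) auto
  then have "hausdorff_premeasure (seq_metric m) t 1 A < ennreal (1 / (2 * K))"
    using zero K by simp
  then obtain U where U: "U \<in> mesh_covers (seq_metric m) 1 A"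
      "(\<Sum>i. diam_powr (seq_metric m) t (U i)) < ennreal (1 / (2 * K))"
    unfolding hausdorff_premeasure_def INF_less_iff by blast
  have "1 \<le> ennreal K * ennreal (1 / (2 * K))"
    using lower[OF U(1)] U(2) by (meson mult_left_mono order_trans less_imp_le zero_le)
  also have "\<dots> = ennreal (1 / 2)" using K by (simp add: ennreal_mult[symmetric])
  finally have "ennreal 1 \<le> ennreal (1 / 2)" by simp
  then show False by (subst (asm) ennreal_le_iff) auto
qed

section \<open>Continuity of the dimension\<close>

lemma shift_funpow: "(shift ^^ n) x = (\<lambda>i. x (n + i))"
  by (induction n) (auto simp: shift_def)

lemma M2_iff:
  "x \<in> M2 m c d \<longleftrightarrow> x \<in> seqs m \<and> x \<preceq> d \<and>
     (\<forall>n\<ge>1. c \<preceq> (\<lambda>i. x (n + i)) \<and> (\<lambda>i. x (n + i)) \<prec> x)"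
  by (auto simp: M2_def shift_funpow)

lemma M2_between:
  assumes "x \<in> M2 m c d"
  shows "c \<preceq> (\<lambda>i. x (q + i))" "(\<lambda>i. x (q + i)) \<preceq> d"
proof -
  have q: "c \<preceq> (\<lambda>i. x (n + i)) \<and> (\<lambda>i. x (n + i)) \<prec> x" if "1 \<le> n" for n
    using assms that by (auto simp: M2_iff)
  have d: "x \<preceq> d" using assms by (auto simp: M2_iff)
  have "c \<preceq> x" using q[of 1] less_fun_trans by blast
  then show "c \<preceq> (\<lambda>i. x (q + i))" using q[of q] by (cases q) auto
  show "(\<lambda>i. x (q + i)) \<preceq> d"
  proof (cases "q = 0")
    case False
    then show ?thesis using q[of q] d lex_le_trans[of "\<lambda>i. x (q + i)" x d] by simp
  qed (use d in simp)
qed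

lemma factor_in_words:
  assumes "x \<in> M2 m c d"
  shows "map x [q..<q + L] \<in> words m c d L"
proof -
  have "x i \<le> m" for i using assms by (auto simp: M2_iff seqs_def)
  moreover have "obeys (<) c (map x [q..<q + L])"
    unfolding obeys_def
  proof (intro allI impI)
    fix k j assume kj: "k + j < length (map x [q..<q + L])" and eq: "\<forall>i<j. map x [q..<q + L] ! (k + i) = c i"
    have "c i = x (q + k + i)" if "i < j" for i using eq[rule_format, OF that] kj that by (simp add: add.assoc)
    then have "c j \<le> x (q + k + j)" using M2_between(1)[OF assms, of "q + k"] unfolding lex_le_iff by blast
    then show "\<not> map x [q..<q + L] ! (k + j) < c j" using kj by (simp add: add.assoc)
  qed
  moreover have "obeys (>) d (map x [q..<q + L])"
    unfolding obeys_def
  proof (intro allI impI)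
    fix k j assume kj: "k + j < length (map x [q..<q + L])" and eq: "\<forall>i<j. map x [q..<q + L] ! (k + i) = d i"
    have "x (q + k + i) = d i" if "i < j" for i using eq[rule_format, OF that] kj that by (simp add: add.assoc)
    then have "x (q + k + j) \<le> d j" using M2_between(2)[OF assms, of "q + k"] unfolding lex_le_iff by blast
    then show "\<not> d j < map x [q..<q + L] ! (k + j)" using kj by (simp add: add.assoc)
  qed
  ultimately show ?thesis by (auto simp: words_def adm_def)
qed

lemma card_prefixes_M2:
  "finite ((\<lambda>x. map x [0..<n * k]) ` M2 m c d) \<and>
   card ((\<lambda>x. map x [0..<n * k]) ` M2 m c d) \<le> card (words m c d n) ^ k"
proof (induction k)
  case 0
  have sub: "(\<lambda>x. map x [0..<n * 0]) ` M2 m c d \<subseteq> {[]}" by auto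
  show ?case using card_mono[OF _ sub] finite_subset[OF sub] by simp
next
  case (Suc k)
  define P where "P k = (\<lambda>x. map x [0..<n * k]) ` M2 m c d" for k
  have IH: "finite (P k)" "card (P k) \<le> card (words m c d n) ^ k" using Suc by (auto simp: P_def)
  have sub: "P (Suc k) \<subseteq> (\<lambda>(u, v). u @ v) ` (P k \<times> words m c d n)"
  proof
    fix z assume "z \<in> P (Suc k)"
    then obtain x where x: "x \<in> M2 m c d" "z = map x [0..<n * Suc k]" by (auto simp: P_def)
    have "[0..<n * Suc k] = [0..<n * k] @ [n * k..<n * k + n]"
      using upt_add_eq_append[of 0 "n * k" n] by (simp add: add.commute)
    then have "z = map x [0..<n * k] @ map x [n * k..<n * k + n]" using x(2) by (simp only: map_append)
    then show "z \<in> (\<lambda>(u, v). u @ v) ` (P k \<times> words m c d n)"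
      using x(1) factor_in_words[OF x(1), of "n * k" n]
      by (intro image_eqI[of _ _ "(map x [0..<n * k], map x [n * k..<n * k + n])"]) (auto simp: P_def)
  qed
  have fin: "finite (P k \<times> words m c d n)" using IH(1) finite_words by blast
  have "card (P (Suc k)) \<le> card ((\<lambda>(u, v). u @ v) ` (P k \<times> words m c d n))"
    using sub fin by (intro card_mono) auto
  also have "\<dots> \<le> card (P k \<times> words m c d n)" using fin by (rule card_image_le)
  also have "\<dots> \<le> card (words m c d n) ^ Suc k" using IH(2) by (simp add: card_cartesian_product)
  finally have "card (P (Suc k)) \<le> card (words m c d n) ^ Suc k" .
  then show ?case using finite_subset[OF sub] fin by (auto simp: P_def)
qed

lemma hausdorff_dim_M2_le:
  fixes s :: real
  assumes m: "1 \<le> m" and s: "0 \<le> s" and n: "0 < n"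
    and few: "card (words m c d n) < real (m + 1) powr (s * n)"
  shows "hausdorff_dim (seq_metric m) (M2 m c d) \<le> ennreal s"
proof (rule hausdorff_dim_le_of_prefix_count[OF m _ s])
  show "M2 m c d \<subseteq> seqs m" by (auto simp: M2_def)
  fix \<delta> \<epsilon> :: real assume pos: "0 < \<delta>" "0 < \<epsilon>"
  define B where "B = real (m + 1)"
  have B: "1 < B" using m by (simp add: B_def)
  define \<theta> where "\<theta> = card (words m c d n) / B powr (s * n)"
  have \<theta>: "0 \<le> \<theta>" "\<theta> < 1" using few B by (auto simp: \<theta>_def B_def)
  have Bn: "1 / B ^ n < 1" "0 \<le> 1 / B ^ n" using B n by (auto simp: divide_less_eq)
  obtain k1 where k1: "\<theta> ^ k1 < \<epsilon>" using real_arch_pow_inv[OF pos(2) \<theta>(2)] by blast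
  obtain k2 where k2: "(1 / B ^ n) ^ k2 < \<delta>" using real_arch_pow_inv[OF pos(1) Bn(1)] by blast
  define k where "k = max k1 k2"
  have "(1 / B ^ n) ^ k \<le> (1 / B ^ n) ^ k2" using Bn by (intro power_decreasing) (auto simp: k_def)
  then have L: "1 / B ^ (n * k) \<le> \<delta>" using k2 by (simp add: power_mult power_divide)
  have "(1 / B ^ (n * k)) powr s = (1 / B powr (s * n)) ^ k"
    using B by (simp add: powr_realpow[symmetric] powr_divide powr_powr power_divide mult_ac)
  then have "real (card ((\<lambda>x. map x [0..<n * k]) ` M2 m c d)) * (1 / B ^ (n * k)) powr s
      = real (card ((\<lambda>x. map x [0..<n * k]) ` M2 m c d)) * (1 / B powr (s * n)) ^ k" by simp
  also have "\<dots> \<le> real (card (words m c d n) ^ k) * (1 / B powr (s * n)) ^ k"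
    using card_prefixes_M2[of n k m c d] by (intro mult_right_mono of_nat_mono) auto
  also have "\<dots> = \<theta> ^ k" by (simp add: \<theta>_def power_divide)
  also have "\<dots> \<le> \<theta> ^ k1" using \<theta> by (intro power_decreasing) (auto simp: k_def)
  finally show "\<exists>L. 1 / real (m + 1) ^ L \<le> \<delta> \<and>
      real (card ((\<lambda>x. map x [0..<L]) ` M2 m c d)) * (1 / real (m + 1) ^ L) powr s \<le> \<epsilon>"
    using L k1 unfolding B_def[symmetric] by (intro exI[of _ "n * k"]) auto
qed

text \<open>The blocks are the loops at a suitable state that are not rotations of the largest loop \<open>b\<close>; the
  prefix is a suffix of a loop followed by \<open>b b\<close>.\<close>

lemma hausdorff_dim_M2_ge:
  fixes s t :: real
  assumes m: "1 \<le> m" and st: "0 < s" "s < t"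
    and many: "\<And>n. real (m + 1) powr (t * n) \<le> card (words m c d n)"
  shows "\<exists>P. \<forall>c' d'. (\<forall>i<P. c' i = c i) \<longrightarrow> (\<forall>i<P. d' i = d i) \<longrightarrow>
    ennreal s \<le> hausdorff_dim (seq_metric m) (M2 m c' d')"
proof -
  define B where "B = real (m + 1)"
  have B: "1 < B" using m by (simp add: B_def)
  have pw: "(B powr u) ^ n = B powr (u * n)" for u n
    using B by (simp add: powr_realpow[symmetric] powr_powr)
  have growth: "(B powr t) ^ n \<le> card (words m c d n)" for n using many[of n] unfolding pw unfolding B_def .
  have r: "1 < B powr s" "B powr s < B powr t" using B st by auto
  obtain N w n where n: "0 < n" and w: "adm m c d w" "matches c w \<subseteq> {..<N}" "matches d w \<subseteq> {..<N}"
    and card: "(B powr s) ^ n + real n \<le> card (Lex.loops m c d w n)"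
    using exists_many_loops[OF r growth] by blast
  define S where "S = Lex.loops m c d w n"
  have S: "finite S" "\<And>a. a \<in> S \<Longrightarrow> length a = n"
    using Lex.finite_loops[of m c d w n] by (auto simp: S_def Lex.loops_def)
  have "0 < (B powr s) ^ n" using B by simp
  then have "S \<noteq> {}" using card n by (auto simp: S_def[symmetric])
  from exists_maximal_shift[OF n S(1) this] obtain a b p where ab: "a \<in> S" "b \<in> S" "p < n"
    and "\<forall>f q. (\<forall>k. f k \<in> S) \<longrightarrow>
      (\<lambda>i. cat n f (q + i)) \<preceq> (\<lambda>i. cat n (\<lambda>k. if k = 0 then a else b) (p + i))"
    by (elim bexE exE conjE)
  then have max: "(\<lambda>i. cat n f (q + i)) \<preceq> (\<lambda>i. cat n (\<lambda>k. if k = 0 then a else b) (p + i))"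
    if "\<And>k. f k \<in> S" for f q using that by simp
  define T where "T = S - (\<lambda>e. rotate e b) ` {..<n}"
  have cardT: "B powr (s * n) \<le> card T"
  proof -
    have "card ((\<lambda>e. rotate e b) ` {..<n}) \<le> n" using card_image_le[of "{..<n}" "\<lambda>e. rotate e b"] by simp
    moreover have "card S - card ((\<lambda>e. rotate e b) ` {..<n}) \<le> card T"
      unfolding T_def by (rule diff_card_le_card_Diff) simp
    ultimately have "real (card S) \<le> card T + real n" by linarith
    then show ?thesis using card unfolding pw S_def by linarith
  qed
  \<comment> \<open>Read from position \<open>p\<close> on, this is a suffix of \<open>a\<close>, then \<open>b b\<close>, then the free blocks.\<close>
  define F where "F f k = (if k = 0 then a else if k < 3 then b else f (k - 3))" for f :: "nat \<Rightarrow> nat list" and k :: nat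
  define e where "e = 3 * n - p"
  define z where "z i = cat n (\<lambda>k. if k = 0 then a else b) (p + i)" for i
  have form: "(\<lambda>i. if i < e then z i else cat n f (i - e)) = (\<lambda>i. cat n (F f) (p + i))" for f
  proof
    fix i
    show "(if i < e then z i else cat n f (i - e)) = cat n (F f) (p + i)"
    proof (cases "i < e")
      case True
      then have "p + i < 3 * n" by (simp add: e_def)
      then have "(p + i) div n < 3" using n by (simp add: less_mult_imp_div_less)
      then show ?thesis using True by (simp add: z_def cat_def F_def)
    next
      case False
      then have "p + i = (i - e) + 3 * n" using ab(3) by (simp add: e_def)
      then have "(p + i) div n = (i - e) div n + 3" "(p + i) mod n = (i - e) mod n" using n by simp_all
      then show ?thesis using False by (simp add: cat_def F_def)
    qed
  qed
  have "ennreal s \<le> hausdorff_dim (seq_metric m) (M2 m c' d')"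
    if agree: "\<forall>i<N + n. c' i = c i" "\<forall>i<N + n. d' i = d i" for c' d'
  proof (rule hausdorff_dim_ge_of_free_blocks[OF m n _ _ st(1) _ _ , where T = T and e = e and z = z])
    show "finite T" using S(1) by (simp add: T_def)
    show "length x = n" if "x \<in> T" for x using that S(2) by (simp add: T_def)
    show "real (m + 1) powr (s * n) \<le> card T" using cardT by (simp add: B_def)
    show "M2 m c' d' \<subseteq> seqs m" by (auto simp: M2_def)
    fix f :: "nat \<Rightarrow> nat list" assume f: "\<And>k. f k \<in> T"
    have FS: "F f k \<in> Lex.loops m c d w n" for k
      using f[of "k - 3"] ab by (auto simp: F_def T_def S_def)
    have between: "c' \<prec> (\<lambda>i. cat n (F f) (q + i))" "(\<lambda>i. cat n (F f) (q + i)) \<prec> d'" "cat n (F f) q \<le> m" for q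
      by (rule loop_sequence_between[OF w FS n agree[rule_format]], assumption+)+
    have dom: "(\<lambda>i. cat n (F f) (p + (q + i))) \<prec> (\<lambda>i. cat n (F f) (p + i))" if "0 < q" for q
      by (rule dominates_its_shifts[where S = S and a = a and b = b])
        (use n ab S(2) max f that in \<open>auto simp: F_def T_def\<close>)
    have "(\<lambda>i. cat n (F f) (p + i)) \<in> M2 m c' d'"
      unfolding M2_iff
    proof (intro conjI allI impI)
      show "(\<lambda>i. cat n (F f) (p + i)) \<in> seqs m" using between by (auto simp: seqs_def)
      show "(\<lambda>i. cat n (F f) (p + i)) \<preceq> d'" using between by auto
      fix q :: nat assume q: "1 \<le> q"
      show "c' \<preceq> (\<lambda>i. cat n (F f) (p + (q + i)))" using between(1)[of "p + q"] by (auto simp: add.assoc)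
      show "(\<lambda>i. cat n (F f) (p + (q + i))) \<prec> (\<lambda>i. cat n (F f) (p + i))" using dom q by simp
    qed
    then show "(\<lambda>i. if i < e then z i else cat n f (i - e)) \<in> M2 m c' d'" unfolding form .
  qed
  then show ?thesis by (intro exI[of _ "N + n"]) auto
qed

lemma obeys_cong:
  assumes "\<And>i. i < length w \<Longrightarrow> c i = c' i"
  shows "obeys R c w \<longleftrightarrow> obeys R c' w"
  unfolding obeys_def using assms by (intro arg_cong[where f = All] ext imp_cong) auto

lemma words_cong:
  assumes "\<And>i. i < n \<Longrightarrow> c i = c' i" "\<And>i. i < n \<Longrightarrow> d i = d' i"
  shows "words m c d n = words m c' d' n"
  unfolding words_def adm_def using assms obeys_cong[of _ c c'] obeys_cong[of _ d d'] by auto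

lemma eventually_agree:
  fixes c d :: "nat \<Rightarrow> nat"
  shows "\<forall>\<^sub>F p in at (c, d) within X. (\<forall>i<n. fst p i = c i) \<and> (\<forall>i<n. snd p i = d i)"
  unfolding eventually_at_topological
  by (rule exI[of _ "{y. \<forall>i<n. y i = c i} \<times> {y. \<forall>i<n. y i = d i}"])
    (auto intro!: open_Times open_cylinder)

text \<open>Below the dimension the upper estimate fails for every length, so the lower estimate applies; it
  holds in a neighbourhood.\<close>

lemma hausdorff_dim_M2_lower_semicontinuous:
  assumes m: "1 \<le> m" and a: "a < hausdorff_dim (seq_metric m) (M2 m c d)" (is "a < ?D")
  shows "\<forall>\<^sub>F p in at (c, d) within X. a < (case p of (c, d) \<Rightarrow> hausdorff_dim (seq_metric m) (M2 m c d))"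
proof -
  obtain v where v: "a < v" "v < ?D" using dense[OF a] by blast
  then obtain u where u: "a < u" "u < v" using dense by blast
  obtain t where t: "v = ennreal t" "0 \<le> t" using v(2) by (cases v) auto
  obtain s where s: "u = ennreal s" "0 \<le> s" using u(2) by (cases u) auto
  have st: "0 < s" "s < t" using u s t by (auto simp: ennreal_less_iff less_le)
  have "real (m + 1) powr (t * n) \<le> card (words m c d n)" for n
  proof (cases "n = 0")
    case True
    then show ?thesis using m by (simp add: words_0)
  next
    case False
    show ?thesis
    proof (rule ccontr)
      assume "\<not> ?thesis"
      then have "?D \<le> ennreal t"
        using False t by (intro hausdorff_dim_M2_le[OF m, where n = n]) auto
      then show False using v t by simp
    qed
  qed
  from hausdorff_dim_M2_ge[OF m st this] obtain P where P: "\<forall>c' d'. (\<forall>i<P. c' i = c i) \<longrightarrow>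
      (\<forall>i<P. d' i = d i) \<longrightarrow> ennreal s \<le> hausdorff_dim (seq_metric m) (M2 m c' d')" ..
  have as: "a < ennreal s" using u s by simp
  from eventually_agree[where c = c and d = d and X = X and n = P]
  show "\<forall>\<^sub>F p in at (c, d) within X. a < (case p of (c, d) \<Rightarrow> hausdorff_dim (seq_metric m) (M2 m c d))"
  proof eventually_elim
    case (elim p)
    then have "ennreal s \<le> hausdorff_dim (seq_metric m) (M2 m (fst p) (snd p))" using P by blast
    with as show ?case unfolding split_beta by (rule less_le_trans)
  qed
qed

text \<open>Above the dimension the lower estimate fails, so the upper estimate holds for some length \<open>n\<close>, and
  its hypothesis only depends on the first \<open>n\<close> entries of the bounds.\<close>

lemma hausdorff_dim_M2_upper_semicontinuous:
  assumes m: "1 \<le> m" and a: "hausdorff_dim (seq_metric m) (M2 m c d) < a" (is "?D < a")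
  shows "\<forall>\<^sub>F p in at (c, d) within X. (case p of (c, d) \<Rightarrow> hausdorff_dim (seq_metric m) (M2 m c d)) < a"
proof -
  obtain v where v: "?D < v" "v < a" using dense[OF a] by blast
  then obtain u where u: "?D < u" "u < v" using dense by blast
  obtain t where t: "v = ennreal t" "0 \<le> t" using v(2) by (cases v) auto
  obtain s where s: "u = ennreal s" "0 \<le> s" using u(2) by (cases u) auto
  have st: "0 < s" "s < t" using u s t by (auto simp: ennreal_less_iff less_le)
  have "\<exists>n. card (words m c d n) < real (m + 1) powr (t * n)"
  proof (rule ccontr)
    assume "\<not> ?thesis"
    then have "real (m + 1) powr (t * n) \<le> card (words m c d n)" for n by (simp add: not_less)
    from hausdorff_dim_M2_ge[OF m st this] have "ennreal s \<le> ?D" by auto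
    then show False using u s by simp
  qed
  then obtain n where few: "card (words m c d n) < real (m + 1) powr (t * n)" ..
  have "n \<noteq> 0"
  proof
    assume "n = 0"
    then show False using few m by (simp add: words_0)
  qed
  have le: "hausdorff_dim (seq_metric m) (M2 m c' d') \<le> ennreal t"
    if "\<forall>i<n. c' i = c i" "\<forall>i<n. d' i = d i" for c' d'
    using few that \<open>n \<noteq> 0\<close> t words_cong[of n c' c d' d m]
    by (intro hausdorff_dim_M2_le[OF m, where n = n]) auto
  have ta: "ennreal t < a" using v t by simp
  from eventually_agree[where c = c and d = d and X = X and n = n]
  show "\<forall>\<^sub>F p in at (c, d) within X. (case p of (c, d) \<Rightarrow> hausdorff_dim (seq_metric m) (M2 m c d)) < a"
  proof eventually_elim
    case (elim p)
    then have "hausdorff_dim (seq_metric m) (M2 m (fst p) (snd p)) \<le> ennreal t" by (intro le) auto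
    then show ?case using ta unfolding split_beta by (rule le_less_trans)
  qed
qed

lemma continuous_on_hausdorff_dim_M2:
  assumes m: "1 \<le> m"
  shows "continuous_on X (\<lambda>(c, d). hausdorff_dim (seq_metric m) (M2 m c d))"
  unfolding continuous_on_def
proof
  fix x :: "(nat \<Rightarrow> nat) \<times> (nat \<Rightarrow> nat)"
  obtain c d where x: "x = (c, d)" by (cases x)
  show "((\<lambda>(c, d). hausdorff_dim (seq_metric m) (M2 m c d)) \<longlongrightarrow>
      (case x of (c, d) \<Rightarrow> hausdorff_dim (seq_metric m) (M2 m c d))) (at x within X)"
    unfolding x prod.case
    by (rule order_tendstoI)
      (fact hausdorff_dim_M2_lower_semicontinuous[OF m] hausdorff_dim_M2_upper_semicontinuous[OF m])+
qed

lemma M1_eq_M2: "M1 m c = M2 m (\<lambda>_. 0) c"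
proof -
  have "(\<lambda>_. 0) \<preceq> x" for x :: "nat \<Rightarrow> nat" unfolding lex_le_iff by simp
  then show ?thesis unfolding M1_def M2_def by (auto simp: Suc_le_eq)
qed

lemma N1_eq_M2: "N1 m c = M2 m c (\<lambda>_. m)"
proof -
  have "x \<preceq> (\<lambda>_. m)" if "x \<in> seqs m" for x unfolding lex_le_iff using that by (simp add: seqs_def)
  then show ?thesis unfolding N1_def M2_def by blast
qed

theorem theorem10:
  fixes m :: nat
  assumes "1 \<le> m"
  shows "continuous_on {(c, d). c \<in> seqs m \<and> d \<in> seqs m \<and> c \<prec> d}
           (\<lambda>(c, d). hausdorff_dim (seq_metric m) (M2 m c d))
       \<and> continuous_on (seqs m) (\<lambda>c. hausdorff_dim (seq_metric m) (M1 m c))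
       \<and> continuous_on (seqs m) (\<lambda>c. hausdorff_dim (seq_metric m) (N1 m c))"
proof (intro conjI)
  have M2: "continuous_on X (\<lambda>(c, d). hausdorff_dim (seq_metric m) (M2 m c d))" for X
    using assms by (rule continuous_on_hausdorff_dim_M2)
  show "continuous_on {(c, d). c \<in> seqs m \<and> d \<in> seqs m \<and> c \<prec> d}
      (\<lambda>(c, d). hausdorff_dim (seq_metric m) (M2 m c d))" by (rule M2)
  have "continuous_on (seqs m) (\<lambda>c :: nat \<Rightarrow> nat. ((\<lambda>_. 0) :: nat \<Rightarrow> nat, c))"
    by (intro continuous_intros)
  from continuous_on_compose2[OF M2[of UNIV] this]
  show "continuous_on (seqs m) (\<lambda>c. hausdorff_dim (seq_metric m) (M1 m c))"
    by (simp add: M1_eq_M2)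
  have "continuous_on (seqs m) (\<lambda>c :: nat \<Rightarrow> nat. (c, (\<lambda>_. m) :: nat \<Rightarrow> nat))"
    by (intro continuous_intros)
  from continuous_on_compose2[OF M2[of UNIV] this]
  show "continuous_on (seqs m) (\<lambda>c. hausdorff_dim (seq_metric m) (N1 m c))"
    by (simp add: N1_eq_M2)
qed

end
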